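(* Let $n>2$ and $V=\mathbb{F}_2^n$. If $\Sigma$ is a Sylow $2$-subgroup of $\mathrm{AGL}(V)$, then $[N_{\mathrm{Sym}(V)}(\Sigma):\Sigma]=2$.
   Context: $\mathrm{AGL}(V)$ is the affine group of maps $x\mapsto xL+v$ with $L\in\mathrm{GL}(V)$, $v\in V$, viewed as a subgroup of $\mathrm{Sym}(V)$. *)

theory Defs
  imports "HOL-Algebra.Algebra"
begin

text \<open>V = F_2^n, realised as functions nat => bool vanishing outside {0..<n}
  (True = 1, False = 0 in F_2).\<close>

definition Vn :: "nat \<Rightarrow> (nat \<Rightarrow> bool) set" where
  "Vn n = {v. \<forall>i\<ge>n. \<not> v i}"

definition vadd :: "(nat \<Rightarrow> bool) \<Rightarrow> (nat \<Rightarrow> bool) \<Rightarrow> (nat \<Rightarrow> bool)" where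
  "vadd u v = (\<lambda>i. u i \<noteq> v i)"

definition vsmult :: "bool \<Rightarrow> (nat \<Rightarrow> bool) \<Rightarrow> (nat \<Rightarrow> bool)" where
  "vsmult c v = (\<lambda>i. c \<and> v i)"

definition GLmap :: "nat \<Rightarrow> ((nat \<Rightarrow> bool) \<Rightarrow> (nat \<Rightarrow> bool)) \<Rightarrow> bool" where
  "GLmap n L \<longleftrightarrow> bij_betw L (Vn n) (Vn n)
     \<and> (\<forall>u\<in>Vn n. \<forall>v\<in>Vn n. L (vadd u v) = vadd (L u) (L v))
     \<and> (\<forall>c. \<forall>u\<in>Vn n. L (vsmult c u) = vsmult c (L u))"

definition AGL :: "nat \<Rightarrow> ((nat \<Rightarrow> bool) \<Rightarrow> (nat \<Rightarrow> bool)) set" where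
  "AGL n = {f \<in> Bij (Vn n). \<exists>L v. GLmap n L \<and> v \<in> Vn n \<and>
                 (\<forall>x\<in>Vn n. f x = vadd (L x) v)}"

definition AGL_group :: "nat \<Rightarrow> ((nat \<Rightarrow> bool) \<Rightarrow> (nat \<Rightarrow> bool)) monoid" where
  "AGL_group n = (BijGroup (Vn n))\<lparr>carrier := AGL n\<rparr>"

definition sylow_subgroup :: "('a, 'b) monoid_scheme \<Rightarrow> nat \<Rightarrow> 'a set \<Rightarrow> bool" where
  "sylow_subgroup G p H \<longleftrightarrow> subgroup H G \<and>
     (\<exists>a. card H = p ^ a \<and> p ^ a dvd card (carrier G) \<and> \<not> p ^ (Suc a) dvd card (carrier G))"

end

theory Submission
  imports Defs
begin

text \<open>
  Let \<open>U\<close> be the group of affine maps that change the \<open>i\<close>-th coordinate by a function of the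
  earlier ones. A \<open>2\<close>-group acting on the nonzero cosets of an invariant proper subspace, whose number
  is odd, fixes one of them; hence every \<open>2\<close>-subgroup of \<open>AGL(V)\<close> stabilises a flag of directions
  and is conjugate into \<open>U\<close>. As \<open>U\<close> is itself a \<open>2\<close>-group, Lagrange's theorem makes the Sylow
  \<open>2\<close>-subgroups exactly the conjugates of \<open>U\<close>, without computing \<open>|AGL(V)|\<close>.

  The only block systems of \<open>U\<close> are the cosets of the standard flag, so a permutation \<open>g\<close>
  normalising \<open>U\<close> is triangular. Conjugating the shears of the last coordinate shows that all
  coordinates of \<open>g\<close> but the last are affine. The last one, \<open>q\<close>, has affine derivative
  \<open>q \<circ> s - q\<close> for every \<open>s \<in> U\<close>, so its polarisation is an alternating \<open>U\<close>-invariant form. Invariance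
  under shears leaves only the forms \<open>c (x\<^sub>0 y\<^sub>1 + x\<^sub>1 y\<^sub>0)\<close>, whence \<open>q\<close> is affine up to the term \<open>c x\<^sub>0 x\<^sub>1\<close>.
  The map adding \<open>x\<^sub>0 x\<^sub>1\<close> to the last coordinate does normalise \<open>U\<close>, and for \<open>n > 2\<close> it is not affine.
\<close>

section \<open>Vectors and affine functions over the two-element field\<close>

definition unit_vec :: "nat \<Rightarrow> nat \<Rightarrow> bool" where
  "unit_vec i = (\<lambda>j. j = i)"

definition zero_vec :: "nat \<Rightarrow> bool" where
  "zero_vec = (\<lambda>j. False)"

text \<open>On \<open>Vn n\<close> this is congruence modulo \<open>tail_space n i\<close>: the
  classes of \<open>agree i\<close> are the cosets of the \<open>i\<close>-th member of the standard
  flag.\<close>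

definition agree :: "nat \<Rightarrow> (nat \<Rightarrow> bool) \<Rightarrow> (nat \<Rightarrow> bool) \<Rightarrow> bool" where
  "agree i x y \<longleftrightarrow> (\<forall>j<i. x j = y j)"

definition tail_space :: "nat \<Rightarrow> nat \<Rightarrow> (nat \<Rightarrow> bool) set" where
  "tail_space n i = {x \<in> Vn n. \<forall>j<i. \<not> x j}"

text \<open>Over the two-element field a function is affine exactly when it preserves sums of three
  points; this form avoids choosing a linear part and a constant.\<close>

definition affine_fun :: "nat \<Rightarrow> ((nat \<Rightarrow> bool) \<Rightarrow> bool) \<Rightarrow> bool" where
  "affine_fun n \<phi> \<longleftrightarrow> (\<forall>x\<in>Vn n. \<forall>y\<in>Vn n. \<forall>z\<in>Vn n.
     \<phi> (vadd (vadd x y) z) = (\<phi> x \<noteq> (\<phi> y \<noteq> \<phi> z)))"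

text \<open>In coordinates, \<open>f\<close> adds to each coordinate a function of the earlier ones.
  This is the automorphism group of the binary tree with leaf set \<open>Vn n\<close>, an iterated
  wreath product of groups of order two.\<close>

definition Tri :: "nat \<Rightarrow> ((nat \<Rightarrow> bool) \<Rightarrow> (nat \<Rightarrow> bool)) set" where
  "Tri n = {f \<in> Bij (Vn n). \<forall>i. \<forall>x\<in>Vn n. \<forall>y\<in>Vn n. agree i (f x) (f y) \<longleftrightarrow> agree i x y}"

lemma vadd_Vn [simp]: "x \<in> Vn n \<Longrightarrow> y \<in> Vn n \<Longrightarrow> vadd x y \<in> Vn n"
  by (simp add: Vn_def vadd_def)

lemma zero_vec_Vn [simp]: "zero_vec \<in> Vn n"
  by (simp add: Vn_def zero_vec_def)

lemma unit_vec_Vn [simp]: "i < n \<Longrightarrow> unit_vec i \<in> Vn n"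
  by (simp add: Vn_def unit_vec_def)

lemma vadd_simps [simp]:
  "vadd x x = zero_vec" "vadd zero_vec x = x" "vadd x zero_vec = x"
  "vadd x (vadd x y) = y" "vadd (vadd y x) x = y"
  by (auto simp: vadd_def zero_vec_def)

lemma vadd_commute: "vadd x y = vadd y x"
  by (auto simp: vadd_def)

lemma vadd_assoc: "vadd (vadd x y) z = vadd x (vadd y z)"
  by (auto simp: vadd_def)

lemma vadd_left_commute: "vadd x (vadd y z) = vadd y (vadd x z)"
  by (auto simp: vadd_def)

lemmas vadd_ac = vadd_assoc vadd_commute vadd_left_commute

lemma vadd_eq_zero: "vadd x y = zero_vec \<longleftrightarrow> x = y"
  by (auto simp: vadd_def zero_vec_def fun_eq_iff)

lemma vadd_cancel [simp]: "vadd x y = vadd x z \<longleftrightarrow> y = z"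
  by (metis vadd_simps(4))

lemma agree_refl [simp]: "agree i x x"
  by (simp add: agree_def)

lemma agree_trans: "agree i x y \<Longrightarrow> agree i y z \<Longrightarrow> agree i x z"
  by (simp add: agree_def)

lemma agree_Suc: "agree (Suc i) x y \<longleftrightarrow> agree i x y \<and> x i = y i"
  by (auto simp: agree_def less_Suc_eq)

lemma agree_all_iff: "x \<in> Vn n \<Longrightarrow> y \<in> Vn n \<Longrightarrow> agree n x y \<longleftrightarrow> x = y"
  unfolding agree_def Vn_def fun_eq_iff mem_Collect_eq by (meson not_le)

lemma tail_space_iff: "x \<in> Vn n \<Longrightarrow> y \<in> Vn n \<Longrightarrow> vadd x y \<in> tail_space n i \<longleftrightarrow> agree i x y"
  by (auto simp: tail_space_def agree_def vadd_def Vn_def)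

lemma bij_betw_tail_space:
  "bij_betw (\<lambda>S i. i \<in> S) (Pow {k..<n}) (tail_space n k)"
proof (rule bij_betwI[where g = "\<lambda>x. {i. x i}"])
  show "(\<lambda>x. {i. x i}) \<in> tail_space n k \<rightarrow> Pow {k..<n}"
    by (auto simp: tail_space_def Vn_def) (metis not_le)+
qed (auto simp: tail_space_def Vn_def)

lemma card_tail_space: "card (tail_space n k) = 2 ^ (n - k)"
  using bij_betw_same_card[OF bij_betw_tail_space] by (simp add: card_Pow)

lemma tail_space_0: "tail_space n 0 = Vn n"
  by (simp add: tail_space_def)

lemma card_Vn: "card (Vn n) = 2 ^ n"
  using card_tail_space[of n 0] by (simp add: tail_space_0)

lemma finite_Vn [simp]: "finite (Vn n)"
  by (rule card_ge_0_finite) (simp add: card_Vn)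

lemma tail_space_subset: "tail_space n i \<subseteq> Vn n"
  by (auto simp: tail_space_def)

lemma tail_space_beyond: "n \<le> j \<Longrightarrow> tail_space n j = {zero_vec}"
  by (auto simp: tail_space_def Vn_def zero_vec_def fun_eq_iff) (meson le_trans not_le)+

lemma tail_space_mono: "i \<le> j \<Longrightarrow> tail_space n j \<subseteq> tail_space n i"
  by (auto simp: tail_space_def)

lemma tail_space_vadd:
  "x \<in> tail_space n i \<Longrightarrow> y \<in> tail_space n i \<Longrightarrow> vadd x y \<in> tail_space n i"
  by (auto simp: tail_space_def Vn_def vadd_def)

lemma zero_tail_space: "zero_vec \<in> tail_space n i"
  by (simp add: tail_space_def Vn_def zero_vec_def)

lemma tail_space_add_pivot:
  "x \<in> tail_space n i \<Longrightarrow> u \<in> tail_space n i \<Longrightarrow> x i \<Longrightarrow> u i \<Longrightarrow> vadd x u \<in> tail_space n (Suc i)"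
  by (auto simp: tail_space_def Vn_def vadd_def less_Suc_eq)

lemma tail_space_SucI: "x \<in> tail_space n i \<Longrightarrow> \<not> x i \<Longrightarrow> x \<in> tail_space n (Suc i)"
  by (auto simp: tail_space_def less_Suc_eq)

lemma unit_vec_tail_space: "i < n \<Longrightarrow> unit_vec i \<in> tail_space n i"
  by (auto simp: tail_space_def unit_vec_def Vn_def)

text \<open>Replaces the expansion of \<open>x\<close> in the basis of unit vectors: adding
  \<open>unit_vec k\<close> clears coordinate \<open>k\<close>, which moves \<open>x\<close> down
  the flag until it is zero.\<close>

lemma additive_zero_on_units:
  assumes add: "\<And>x y. x \<in> Vn n \<Longrightarrow> y \<in> Vn n \<Longrightarrow> F (vadd x y) = (F x \<noteq> F y)"
    and units: "\<And>i. i < n \<Longrightarrow> \<not> F (unit_vec i)"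
    and "x \<in> Vn n"
  shows "\<not> F x"
proof -
  have "\<not> F x" if "x \<in> tail_space n k" "k \<le> n" for k x
    using that(2,1)
  proof (induction k arbitrary: x rule: inc_induct)
    case base
    then have "x = zero_vec" by (simp add: tail_space_beyond)
    then show ?case using add[of zero_vec zero_vec] by simp
  next
    case (step k)
    have xV: "x \<in> Vn n" using step.prems tail_space_subset by blast
    show ?case
    proof (cases "x k")
      case True
      have "vadd x (unit_vec k) \<in> tail_space n (Suc k)"
        using step.prems step.hyps True
        by (auto simp: tail_space_def Vn_def vadd_def unit_vec_def less_Suc_eq)
      then have "\<not> F (vadd x (unit_vec k))" using step.IH by simp
      then show ?thesis using add[OF xV, of "unit_vec k"] units[of k] step.hyps by auto
    next
      case False
      then have "x \<in> tail_space n (Suc k)"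
        using step.prems by (auto simp: tail_space_def less_Suc_eq)
      then show ?thesis by (rule step.IH)
    qed
  qed
  from this[of x 0] show ?thesis using assms(3) by (simp add: tail_space_0)
qed

section \<open>Affine functions and the coordinatewise description of the affine group\<close>

lemma affine_funD:
  "affine_fun n \<phi> \<Longrightarrow> x \<in> Vn n \<Longrightarrow> y \<in> Vn n \<Longrightarrow> z \<in> Vn n \<Longrightarrow>
    \<phi> (vadd (vadd x y) z) = (\<phi> x \<noteq> (\<phi> y \<noteq> \<phi> z))"
  by (simp add: affine_fun_def)

lemma affine_map_vadd3:
  assumes "\<And>i. affine_fun n (\<lambda>x. f x i)" "x \<in> Vn n" "y \<in> Vn n" "z \<in> Vn n"
  shows "f (vadd (vadd x y) z) = vadd (vadd (f x) (f y)) (f z)"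
proof
  fix i
  show "f (vadd (vadd x y) z) i = vadd (vadd (f x) (f y)) (f z) i"
    using affine_funD[OF assms(1,2-4), of i] by (simp add: vadd_def[of _ "f z"] vadd_def[of "f x"]) metis
qed

lemma affine_funI:
  "(\<And>x y z. x \<in> Vn n \<Longrightarrow> y \<in> Vn n \<Longrightarrow> z \<in> Vn n \<Longrightarrow>
    \<phi> (vadd (vadd x y) z) = (\<phi> x \<noteq> (\<phi> y \<noteq> \<phi> z))) \<Longrightarrow> affine_fun n \<phi>"
  by (simp add: affine_fun_def)

lemma affine_fun_xor:
  assumes "affine_fun n \<phi>" "affine_fun n \<psi>"
  shows "affine_fun n (\<lambda>x. \<phi> x \<noteq> \<psi> x)"
proof (rule affine_funI)
  fix x y z assume V: "x \<in> Vn n" "y \<in> Vn n" "z \<in> Vn n"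
  show "(\<phi> (vadd (vadd x y) z) \<noteq> \<psi> (vadd (vadd x y) z)) =
    ((\<phi> x \<noteq> \<psi> x) \<noteq> ((\<phi> y \<noteq> \<psi> y) \<noteq> (\<phi> z \<noteq> \<psi> z)))"
    using affine_funD[OF assms(1) V] affine_funD[OF assms(2) V] by argo
qed

lemma affine_fun_coord: "affine_fun n (\<lambda>x. x i)"
  by (auto simp: affine_fun_def vadd_def)

text \<open>Every function from the two-element field to itself is affine. For functions of two
  coordinates this fails, the product being the first example.\<close>

lemma affine_fun_comp_coord: "affine_fun n (\<lambda>x. \<phi> (x i))"
proof (rule affine_funI)
  fix x y z :: "nat \<Rightarrow> bool"
  show "\<phi> (vadd (vadd x y) z i) = (\<phi> (x i) \<noteq> (\<phi> (y i) \<noteq> \<phi> (z i)))"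
    by (cases "x i"; cases "y i"; cases "z i"; cases "\<phi> True"; cases "\<phi> False")
      (simp_all add: vadd_def)
qed

lemma affine_fun_cong: "(\<And>x. x \<in> Vn n \<Longrightarrow> \<phi> x = \<psi> x) \<Longrightarrow> affine_fun n \<phi> = affine_fun n \<psi>"
  by (simp add: affine_fun_def)

lemma affine_fun_comp:
  assumes "affine_fun n \<phi>" "\<And>i. affine_fun n (\<lambda>x. f x i)" "\<And>x. x \<in> Vn n \<Longrightarrow> f x \<in> Vn n"
  shows "affine_fun n (\<lambda>x. \<phi> (f x))"
  by (rule affine_funI) (simp add: affine_map_vadd3[OF assms(2)] affine_funD[OF assms(1)] assms(3))

lemma BijD [simp]: "f \<in> Bij (Vn n) \<Longrightarrow> x \<in> Vn n \<Longrightarrow> f x \<in> Vn n"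
  by (rule funcset_mem[OF Bij_imp_funcset])

lemma Bij_inj: "f \<in> Bij (Vn n) \<Longrightarrow> x \<in> Vn n \<Longrightarrow> y \<in> Vn n \<Longrightarrow> f x = f y \<longleftrightarrow> x = y"
  by (auto simp: Bij_def bij_betw_def dest: inj_onD)

lemma restrict_Bij:
  assumes "\<And>x. x \<in> Vn n \<Longrightarrow> f x \<in> Vn n" "inj_on f (Vn n)"
  shows "restrict f (Vn n) \<in> Bij (Vn n)"
proof -
  have "f ` Vn n = Vn n"
    using assms(1) card_image[OF assms(2)] by (intro card_subset_eq finite_Vn) blast+
  then show ?thesis using assms(2) by (simp add: Bij_def bij_betw_def)
qed

text \<open>A map preserving triple sums becomes additive once its value at zero is subtracted, and
  additive maps respect the only scalars, 0 and 1. Membership can therefore be tested one coordinate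
  at a time.\<close>

lemma AGL_eq: "AGL n = {f \<in> Bij (Vn n). \<forall>i. affine_fun n (\<lambda>x. f x i)}"
proof (intro equalityI subsetI)
  fix f assume "f \<in> AGL n"
  then obtain L v where f: "f \<in> Bij (Vn n)" and L: "GLmap n L" "\<And>x. x \<in> Vn n \<Longrightarrow> f x = vadd (L x) v"
    by (auto simp: AGL_def)
  have "affine_fun n (\<lambda>x. f x i)" for i
  proof (rule affine_funI)
    fix x y z assume V: "x \<in> Vn n" "y \<in> Vn n" "z \<in> Vn n"
    then have "f (vadd (vadd x y) z) = vadd (vadd (vadd (L x) (L y)) (L z)) v"
      using L(1) by (simp add: GLmap_def L(2))
    then show "f (vadd (vadd x y) z) i = (f x i \<noteq> (f y i \<noteq> f z i))"
      using V by (simp add: L(2) vadd_def) argo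
  qed
  with f show "f \<in> {f \<in> Bij (Vn n). \<forall>i. affine_fun n (\<lambda>x. f x i)}" by simp
next
  fix f assume "f \<in> {f \<in> Bij (Vn n). \<forall>i. affine_fun n (\<lambda>x. f x i)}"
  then have f: "f \<in> Bij (Vn n)" and aff: "\<And>i. affine_fun n (\<lambda>x. f x i)" by auto
  define L where "L = (\<lambda>x. vadd (f x) (f zero_vec))"
  have L0: "L zero_vec = zero_vec" by (simp add: L_def)
  have add: "L (vadd u v) = vadd (L u) (L v)" if "u \<in> Vn n" "v \<in> Vn n" for u v
    using affine_map_vadd3[OF aff that zero_vec_Vn] by (simp add: L_def vadd_ac)
  have "L (vsmult c u) = vsmult c (L u)" for c u
  proof (cases c)
    case False
    then have "vsmult c w = zero_vec" for w by (simp add: vsmult_def zero_vec_def)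
    then show ?thesis using L0 by simp
  qed (simp add: vsmult_def)
  moreover have "bij_betw L (Vn n) (Vn n)"
  proof -
    have inj: "inj_on L (Vn n)"
      using f by (simp add: L_def inj_on_def Bij_inj vadd_commute[of _ "f zero_vec"])
    moreover have "L ` Vn n = Vn n"
      using card_image[OF inj] f by (intro card_subset_eq finite_Vn) (auto simp: L_def)
    ultimately show ?thesis by (simp add: bij_betw_def)
  qed
  ultimately have "GLmap n L" using add by (simp add: GLmap_def)
  moreover have "f x = vadd (L x) (f zero_vec)" for x by (simp add: L_def)
  ultimately show "f \<in> AGL n" using f BijD[OF f zero_vec_Vn] unfolding AGL_def by blast
qed

section \<open>Affine and triangular permutations\<close>

abbreviation SymV :: "nat \<Rightarrow> ((nat \<Rightarrow> bool) \<Rightarrow> (nat \<Rightarrow> bool)) monoid" where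
  "SymV n \<equiv> BijGroup (Vn n)"

lemma carrier_SymV [simp]: "carrier (SymV n) = Bij (Vn n)"
  by (simp add: BijGroup_def)

lemma mult_SymV [simp]:
  "f \<in> Bij (Vn n) \<Longrightarrow> g \<in> Bij (Vn n) \<Longrightarrow> x \<in> Vn n \<Longrightarrow> (f \<otimes>\<^bsub>SymV n\<^esub> g) x = f (g x)"
  by (simp add: BijGroup_def compose_def)

lemma one_SymV [simp]: "x \<in> Vn n \<Longrightarrow> \<one>\<^bsub>SymV n\<^esub> x = x"
  by (simp add: BijGroup_def)

lemma Bij_eqI: "f \<in> Bij (Vn n) \<Longrightarrow> g \<in> Bij (Vn n) \<Longrightarrow> (\<And>x. x \<in> Vn n \<Longrightarrow> f x = g x) \<Longrightarrow> f = g"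
  by (auto intro: extensionalityI dest: Bij_imp_extensional)

lemma mult_Bij [simp]: "f \<in> Bij (Vn n) \<Longrightarrow> g \<in> Bij (Vn n) \<Longrightarrow> f \<otimes>\<^bsub>SymV n\<^esub> g \<in> Bij (Vn n)"
  using monoid.m_closed[OF group.is_monoid[OF group_BijGroup], of f "Vn n" g] by simp

lemma inv_Bij [simp]: "f \<in> Bij (Vn n) \<Longrightarrow> inv\<^bsub>SymV n\<^esub> f \<in> Bij (Vn n)"
  using group.inv_closed[OF group_BijGroup, of f "Vn n"] by simp

lemma inv_SymV [simp]:
  assumes "f \<in> Bij (Vn n)" "x \<in> Vn n"
  shows "f ((inv\<^bsub>SymV n\<^esub> f) x) = x" "(inv\<^bsub>SymV n\<^esub> f) (f x) = x"
proof -
  have "(f \<otimes>\<^bsub>SymV n\<^esub> inv\<^bsub>SymV n\<^esub> f) x = x" "(inv\<^bsub>SymV n\<^esub> f \<otimes>\<^bsub>SymV n\<^esub> f) x = x"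
    using assms group.r_inv[OF group_BijGroup, of f "Vn n"] group.l_inv[OF group_BijGroup, of f "Vn n"]
    by simp_all
  then show "f ((inv\<^bsub>SymV n\<^esub> f) x) = x" "(inv\<^bsub>SymV n\<^esub> f) (f x) = x"
    using assms by simp_all
qed

lemma TriI:
  "f \<in> Bij (Vn n) \<Longrightarrow>
    (\<And>i x y. x \<in> Vn n \<Longrightarrow> y \<in> Vn n \<Longrightarrow> agree i (f x) (f y) \<longleftrightarrow> agree i x y) \<Longrightarrow> f \<in> Tri n"
  by (simp add: Tri_def)

lemma Tri_agree: "f \<in> Tri n \<Longrightarrow> x \<in> Vn n \<Longrightarrow> y \<in> Vn n \<Longrightarrow> agree i (f x) (f y) \<longleftrightarrow> agree i x y"
  by (simp add: Tri_def)

lemma AGLI: "f \<in> Bij (Vn n) \<Longrightarrow> (\<And>i. affine_fun n (\<lambda>x. f x i)) \<Longrightarrow> f \<in> AGL n"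
  by (simp add: AGL_eq)

lemma AGL_affine: "f \<in> AGL n \<Longrightarrow> affine_fun n (\<lambda>x. f x i)"
  by (simp add: AGL_eq)

lemma Tri_Bij [simp]: "f \<in> Tri n \<Longrightarrow> f \<in> Bij (Vn n)"
  by (simp add: Tri_def)

lemma AGL_Bij [simp]: "f \<in> AGL n \<Longrightarrow> f \<in> Bij (Vn n)"
  by (simp add: AGL_eq)

lemma AGL_vadd3:
  "f \<in> AGL n \<Longrightarrow> x \<in> Vn n \<Longrightarrow> y \<in> Vn n \<Longrightarrow> z \<in> Vn n \<Longrightarrow>
    f (vadd (vadd x y) z) = vadd (vadd (f x) (f y)) (f z)"
  by (rule affine_map_vadd3[of n f]) (simp_all only: AGL_affine)

text \<open>Comparing \<open>agree (Suc i)\<close> with \<open>agree i\<close> shows that, on points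
  with the same first \<open>i\<close> coordinates, \<open>f\<close> either keeps coordinate
  \<open>i\<close> throughout or flips it throughout.\<close>

lemma Tri_coord:
  "f \<in> Tri n \<Longrightarrow> x \<in> Vn n \<Longrightarrow> y \<in> Vn n \<Longrightarrow> agree i x y \<Longrightarrow> (f x i = f y i) = (x i = y i)"
  using Tri_agree[of f n x y "Suc i"] Tri_agree[of f n x y i] by (simp add: agree_Suc)

lemma one_Bij [simp]: "\<one>\<^bsub>SymV n\<^esub> \<in> Bij (Vn n)"
  by (simp add: BijGroup_def id_Bij)

lemma subgroup_Tri: "subgroup (Tri n) (SymV n)"
proof (rule group.subgroupI[OF group_BijGroup])
  have "\<one>\<^bsub>SymV n\<^esub> \<in> Tri n" by (rule TriI) simp_all
  then show "Tri n \<noteq> {}" by blast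
  show "inv\<^bsub>SymV n\<^esub> f \<in> Tri n" if f: "f \<in> Tri n" for f
  proof (rule TriI)
    fix i x y assume "x \<in> Vn n" "y \<in> Vn n"
    then show "agree i ((inv\<^bsub>SymV n\<^esub> f) x) ((inv\<^bsub>SymV n\<^esub> f) y) = agree i x y"
      using f Tri_agree[OF f, of "(inv\<^bsub>SymV n\<^esub> f) x" "(inv\<^bsub>SymV n\<^esub> f) y" i] by simp
  qed (use f in simp)
  show "f \<otimes>\<^bsub>SymV n\<^esub> g \<in> Tri n" if "f \<in> Tri n" "g \<in> Tri n" for f g
    by (rule TriI) (use that in \<open>simp_all add: Tri_agree\<close>)
qed auto

lemma subgroup_AGL: "subgroup (AGL n) (SymV n)"
proof (rule group.subgroupI[OF group_BijGroup])
  have "affine_fun n (\<lambda>x. \<one>\<^bsub>SymV n\<^esub> x i) = affine_fun n (\<lambda>x. x i)" for i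
    by (rule affine_fun_cong) simp
  then have "\<one>\<^bsub>SymV n\<^esub> \<in> AGL n" by (intro AGLI) (simp_all add: affine_fun_coord)
  then show "AGL n \<noteq> {}" by blast
  show "inv\<^bsub>SymV n\<^esub> f \<in> AGL n" if f: "f \<in> AGL n" for f
  proof -
    let ?g = "inv\<^bsub>SymV n\<^esub> f"
    have fB: "f \<in> Bij (Vn n)" and gB: "?g \<in> Bij (Vn n)" using f by simp_all
    have *: "?g (vadd (vadd x y) z) = vadd (vadd (?g x) (?g y)) (?g z)"
      if V: "x \<in> Vn n" "y \<in> Vn n" "z \<in> Vn n" for x y z
    proof -
      have "f (vadd (vadd (?g x) (?g y)) (?g z)) = vadd (vadd x y) z"
        using V f by (simp add: AGL_vadd3)
      then show ?thesis using V fB gB by (metis BijD inv_SymV(2) vadd_Vn)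
    qed
    have "affine_fun n (\<lambda>x. ?g x i)" for i
    proof (rule affine_funI)
      fix x y z assume "x \<in> Vn n" "y \<in> Vn n" "z \<in> Vn n"
      then show "?g (vadd (vadd x y) z) i = (?g x i \<noteq> (?g y i \<noteq> ?g z i))"
        by (subst *) (simp_all add: vadd_def, argo)
    qed
    then show ?thesis using gB by (rule AGLI[rotated])
  qed
  show "f \<otimes>\<^bsub>SymV n\<^esub> g \<in> AGL n" if "f \<in> AGL n" "g \<in> AGL n" for f g
  proof (rule AGLI)
    fix i
    have "affine_fun n (\<lambda>x. (f \<otimes>\<^bsub>SymV n\<^esub> g) x i) = affine_fun n (\<lambda>x. f (g x) i)"
      by (rule affine_fun_cong) (simp add: that)
    also have "\<dots>"
      by (rule affine_fun_comp[where \<phi> = "\<lambda>y. f y i"]) (simp_all add: that AGL_affine)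
    finally show "affine_fun n (\<lambda>x. (f \<otimes>\<^bsub>SymV n\<^esub> g) x i)" .
  qed (use that in simp)
qed auto

definition Unitri :: "nat \<Rightarrow> ((nat \<Rightarrow> bool) \<Rightarrow> (nat \<Rightarrow> bool)) set" where
  "Unitri n = AGL n \<inter> Tri n"

lemma subgroup_Unitri: "subgroup (Unitri n) (SymV n)"
  unfolding Unitri_def
  by (rule group.subgroups_Inter_pair[OF group_BijGroup subgroup_AGL subgroup_Tri])

lemma UnitriI: "f \<in> Tri n \<Longrightarrow> (\<And>i. affine_fun n (\<lambda>x. f x i)) \<Longrightarrow> f \<in> Unitri n"
  by (simp add: Unitri_def AGLI)

lemma UnitriD [simp]: "f \<in> Unitri n \<Longrightarrow> f \<in> Tri n" "f \<in> Unitri n \<Longrightarrow> f \<in> AGL n"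
  by (simp_all add: Unitri_def)

section \<open>Shears and translations as triangular affine maps\<close>

text \<open>A single earlier coordinate as \<open>p\<close> gives a transvection, a product of two
  gives \<open>quad_shear\<close>; hence the general \<open>p\<close>.\<close>

definition shear :: "nat \<Rightarrow> nat \<Rightarrow> ((nat \<Rightarrow> bool) \<Rightarrow> bool) \<Rightarrow> (nat \<Rightarrow> bool) \<Rightarrow> (nat \<Rightarrow> bool)" where
  "shear n k p = (\<lambda>x\<in>Vn n. x(k := (x k \<noteq> p x)))"

text \<open>The added term depends only on coordinates before \<open>k\<close>, so it can change
  whether two points agree at \<open>k\<close> only if they already differ earlier.\<close>

lemma shear_Tri:
  assumes k: "k < n" and p: "\<And>x y. x \<in> Vn n \<Longrightarrow> y \<in> Vn n \<Longrightarrow> agree k x y \<Longrightarrow> p x = p y"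
  shows "shear n k p \<in> Tri n"
proof -
  let ?f = "\<lambda>x. x(k := (x k \<noteq> p x))"
  have V: "?f x \<in> Vn n" if "x \<in> Vn n" for x using that k by (simp add: Vn_def)
  have iff: "agree i (?f x) (?f y) \<longleftrightarrow> agree i x y" if V: "x \<in> Vn n" "y \<in> Vn n" for x y i
  proof (cases "k < i \<and> (\<forall>j<i. j \<noteq> k \<longrightarrow> x j = y j)")
    case True
    then have "p x = p y" by (intro p[OF V]) (simp add: agree_def)
    then have "?f x j = ?f y j \<longleftrightarrow> x j = y j" for j by auto
    then show ?thesis by (simp only: agree_def)
  next
    case False
    then show ?thesis
    proof (cases "k < i")
      case True
      with False obtain j where "j < i" "j \<noteq> k" "x j \<noteq> y j" by blast
      then have "\<not> agree i (?f x) (?f y)" "\<not> agree i x y" by (auto simp: agree_def)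
      then show ?thesis by simp
    next
      case False
      then have "?f x j = x j" "?f y j = y j" if "j < i" for j using that by simp_all
      then show ?thesis by (simp add: agree_def)
    qed
  qed
  have "inj_on ?f (Vn n)"
  proof (rule inj_onI)
    fix x y assume xy: "x \<in> Vn n" "y \<in> Vn n" "?f x = ?f y"
    then have "agree n x y" using iff[OF xy(1,2), of n] by simp
    then show "x = y" using xy by (simp add: agree_all_iff)
  qed
  then have "shear n k p \<in> Bij (Vn n)"
    unfolding shear_def using V by (intro restrict_Bij)
  then show ?thesis by (rule TriI) (simp only: shear_def restrict_apply' iff)
qed

lemma shear_apply: "x \<in> Vn n \<Longrightarrow> shear n k p x = x(k := (x k \<noteq> p x))"
  by (simp add: shear_def)

lemma shear_coord_eq:
  "x \<in> Vn n \<Longrightarrow> shear n k (\<lambda>x. x i) x = (if x i then vadd x (unit_vec k) else x)"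
  by (auto simp: shear_def vadd_def unit_vec_def fun_eq_iff)

lemma affine_fun_shear:
  assumes "affine_fun n p"
  shows "affine_fun n (\<lambda>x. shear n k p x j)"
proof -
  have "affine_fun n (\<lambda>x. if j = k then x k \<noteq> p x else x j)"
    using assms affine_fun_xor[OF affine_fun_coord, of n p k]
    by (cases "j = k") (simp_all only: if_True if_False affine_fun_coord refl)
  also have "affine_fun n (\<lambda>x. if j = k then x k \<noteq> p x else x j) = ?thesis"
    by (rule affine_fun_cong) (simp add: shear_def)
  finally show ?thesis .
qed

lemma shear_coord_Unitri:
  assumes "k < n" "i < k" shows "shear n k (\<lambda>x. x i) \<in> Unitri n"
proof (rule UnitriI)
  show "shear n k (\<lambda>x. x i) \<in> Tri n"
    by (rule shear_Tri) (use assms in \<open>auto simp: agree_def\<close>)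
qed (simp add: affine_fun_shear affine_fun_coord)

lemma translation_Unitri:
  assumes v: "v \<in> Vn n" shows "restrict (vadd v) (Vn n) \<in> Unitri n"
proof (rule UnitriI)
  have "restrict (vadd v) (Vn n) \<in> Bij (Vn n)"
    by (rule restrict_Bij) (use v in \<open>auto simp: inj_on_def\<close>)
  then show "restrict (vadd v) (Vn n) \<in> Tri n"
    by (rule TriI) (auto simp: vadd_def agree_def)
  have "affine_fun n (\<lambda>x. v i \<noteq> x i)" for i
    by (auto simp: affine_fun_def vadd_def)
  also have "affine_fun n (\<lambda>x. v i \<noteq> x i) = affine_fun n (\<lambda>x. restrict (vadd v) (Vn n) x i)" for i
    by (rule affine_fun_cong) (simp add: vadd_def)
  finally show "affine_fun n (\<lambda>x. restrict (vadd v) (Vn n) x i)" for i .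
qed

section \<open>Group theory\<close>

text \<open>Another prime \<open>q\<close> dividing the order would give a nontrivial element whose
  order divides both \<open>q\<close> and \<open>p ^ k\<close>.\<close>

lemma (in group) order_prime_power:
  assumes fin: "finite (carrier G)" and p: "normalization_semidom_class.prime p"
    and exp: "\<And>x. x \<in> carrier G \<Longrightarrow> x [^] (p ^ k) = \<one>"
  shows "\<exists>a. order G = p ^ a"
proof -
  have pos: "order G \<noteq> 0" using fin order_gt_0_iff_finite by simp
  obtain m where m: "order G = p ^ multiplicity p (order G) * m" "\<not> p dvd m"
    using multiplicity_decompose'[OF pos, of p] p by (metis not_prime_unit)
  have "m = 1"
  proof (rule ccontr)
    assume "m \<noteq> 1"
    then obtain q where q: "normalization_semidom_class.prime q" "q dvd m" using prime_factor_nat by blast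
    then have "q \<noteq> p" using m(2) by blast
    obtain b where b: "order G = q ^ 1 * b" using q(2) m(1)
      by (metis dvd_def dvd_mult power_one_right)
    \<comment> \<open>With exponent 1, Sylow's existence theorem supplies a subgroup of order
      \<open>q\<close>, as in Cauchy's theorem.\<close>
    obtain H where H: "subgroup H G" "card H = q ^ 1"
      using sylow_thm[OF q(1) is_group b fin] by blast
    have "card H \<noteq> 1" using H(2) q(1) by (auto simp: prime_nat_iff)
    then have "H \<noteq> {\<one>}" by auto
    then obtain h where h: "h \<in> H" "h \<noteq> \<one>" using subgroup.one_closed[OF H(1)] by blast
    have hG: "h \<in> carrier G" using subgroup.mem_carrier[OF H(1) h(1)] .
    have "h [^]\<^bsub>G\<lparr>carrier := H\<rparr>\<^esub> order (G\<lparr>carrier := H\<rparr>) = \<one>"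
      using group.pow_order_eq_1[OF subgroup.subgroup_is_group[OF H(1) is_group], of h] h by simp
    then have "h [^] (q ^ 1) = \<one>"
      using H by (simp add: order_def nat_pow_consistent[symmetric])
    then have "ord h dvd q ^ 1" using pow_eq_id[OF hG] by blast
    moreover have "ord h dvd p ^ k" using exp[OF hG] pow_eq_id[OF hG] by blast
    moreover have "coprime (q ^ 1) (p ^ k)"
      using q(1) p \<open>q \<noteq> p\<close> by (simp add: primes_coprime)
    ultimately have "ord h = 1" by (metis coprime_common_divisor_nat)
    then show False using ord_eq_1[OF hG] h(2) by simp
  qed
  then show ?thesis using m(1) by auto
qed

text \<open>Orbit sizes divide \<open>p ^ a\<close>; without a fixed point each of them, and hence
  \<open>card E\<close>, would be divisible by \<open>p\<close>.\<close>

lemma (in group_action) prime_power_fixed_point: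
  assumes "finite E" and ord: "order G = p ^ a" and p: "normalization_semidom_class.prime p" and nd: "\<not> p dvd card E"
  shows "\<exists>x\<in>E. \<forall>g\<in>carrier G. \<phi> g x = x"
proof (rule ccontr)
  assume no: "\<not> ?thesis"
  interpret P: partition E "orbits G E \<phi>" by (rule orbit_partition)
  have "p dvd card c" if c: "c \<in> orbits G E \<phi>" for c
  proof -
    obtain x where x: "x \<in> E" "c = orbit G \<phi> x" using c unfolding orbits_def by blast
    have "card c dvd p ^ a" unfolding x(2) ord[symmetric] orbit_stabilizer_theorem[OF x(1), symmetric]
      by (rule dvd_triv_left)
    then obtain i where i: "card c = p ^ i" using divides_primepow_nat[OF p] by blast
    moreover have "card c \<noteq> 1"
    proof
      assume "card c = 1"
      then have "c = {x}" using orbit_refl[OF x(1)] x(2) by (metis card_1_singletonE singletonD)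
      then have "\<forall>g\<in>carrier G. \<phi> g x = x" using x(2) unfolding orbit_def by blast
      then show False using no x(1) by blast
    qed
    ultimately show ?thesis using i by (cases i) simp_all
  qed
  moreover have "finite (\<Union>(orbits G E \<phi>))" using assms(1) by (simp only: P.partition_coverture)
  ultimately have "p dvd card (\<Union>(orbits G E \<phi>))"
    using P.disjoint_union by (intro dvd_partition) blast+
  then show False using nd by (simp add: P.partition_coverture)
qed

text \<open>\<open>normalizer\<close> is the stabiliser of \<open>H\<close> under conjugation of
  subsets. Equality of \<open>H\<close> with its conjugate splits into two inclusions, the second
  one being the condition for \<open>inv g\<close>.\<close>

lemma (in group) mem_normalizer_iff:
  assumes H: "subgroup H G"
  shows "g \<in> normalizer G H \<longleftrightarrow>
    g \<in> carrier G \<and> (\<forall>s\<in>H. g \<otimes> s \<otimes> inv g \<in> H) \<and> (\<forall>s\<in>H. inv g \<otimes> s \<otimes> g \<in> H)"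
proof -
  have HG: "H \<subseteq> carrier G" by (rule subgroup.subset[OF H])
  have eq: "g <# H #> inv g = (\<lambda>s. g \<otimes> s \<otimes> inv g) ` H"
    unfolding l_coset_def r_coset_def by blast
  have "g <# H #> inv g = H \<longleftrightarrow>
    (\<forall>s\<in>H. g \<otimes> s \<otimes> inv g \<in> H) \<and> (\<forall>s\<in>H. inv g \<otimes> s \<otimes> g \<in> H)" if g: "g \<in> carrier G"
  proof -
    have h: "g \<otimes> (inv g \<otimes> s) = s" "inv g \<otimes> (g \<otimes> s) = s" if "s \<in> carrier G" for s
      using that g by (simp_all add: m_assoc[symmetric])
    have c1: "g \<otimes> (inv g \<otimes> s \<otimes> g) \<otimes> inv g = s" and c2: "inv g \<otimes> (g \<otimes> s \<otimes> inv g) \<otimes> g = s"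
      if "s \<in> H" for s
      using subsetD[OF HG that] g by (simp_all add: m_assoc h)
    show ?thesis unfolding eq
    proof (intro iffI conjI ballI)
      fix s assume *: "(\<lambda>s. g \<otimes> s \<otimes> inv g) ` H = H" and s: "s \<in> H"
      have "g \<otimes> s \<otimes> inv g \<in> (\<lambda>s. g \<otimes> s \<otimes> inv g) ` H" using s by (rule imageI)
      then show "g \<otimes> s \<otimes> inv g \<in> H" by (simp only: *)
      have "s \<in> (\<lambda>s. g \<otimes> s \<otimes> inv g) ` H" using s by (simp only: *)
      then obtain t where "t \<in> H" "s = g \<otimes> t \<otimes> inv g" by (rule imageE)
      then show "inv g \<otimes> s \<otimes> g \<in> H" using c2 by simp
    next
      assume *: "(\<forall>s\<in>H. g \<otimes> s \<otimes> inv g \<in> H) \<and> (\<forall>s\<in>H. inv g \<otimes> s \<otimes> g \<in> H)"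
      show "(\<lambda>s. g \<otimes> s \<otimes> inv g) ` H = H"
      proof (intro equalityI subsetI)
        fix s assume "s \<in> H"
        then show "s \<in> (\<lambda>s. g \<otimes> s \<otimes> inv g) ` H"
          using * c1 by (intro rev_image_eqI[of "inv g \<otimes> s \<otimes> g"]) simp_all
      qed (use * in blast)
    qed
  qed
  moreover have "g \<in> normalizer G H \<longleftrightarrow> g \<in> carrier G \<and> g <# H #> inv g = H"
    using HG by (simp add: normalizer_def stabilizer_def)
  ultimately show ?thesis by blast
qed

text \<open>If \<open>g \<otimes> t\<close> lies in \<open>H\<close>, then \<open>g\<close> lies in
  the coset of \<open>inv t\<close>. So \<open>cov\<close> leaves just two cosets, which differ
  because \<open>t\<close> is outside \<open>H\<close>.\<close>

lemma (in group) index_normalizer_eq_2: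
  assumes H: "subgroup H G" and t: "t \<in> normalizer G H" "t \<notin> H"
    and cov: "\<And>g. g \<in> normalizer G H \<Longrightarrow> g \<in> H \<or> g \<otimes> t \<in> H"
  shows "card (rcosets\<^bsub>G\<lparr>carrier := normalizer G H\<rparr>\<^esub> H) = 2"
proof -
  let ?N = "normalizer G H"
  have N: "subgroup ?N G" using normalizer_imp_subgroup[OF subgroup.subset[OF H]] .
  have HN: "H \<subseteq> ?N"
    using subgroup.subset[OF H] subgroup.m_closed[OF H] subgroup.m_inv_closed[OF H]
    by (intro subsetI) (simp add: mem_normalizer_iff[OF H] subset_iff)
  have tG: "t \<in> carrier G" using N t(1) by (rule subgroup.mem_carrier)
  have it: "inv t \<in> ?N" using subgroup.m_inv_closed[OF N t(1)] .
  have "H #> g = H \<or> H #> g = H #> inv t" if g: "g \<in> ?N" for g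
  proof -
    have gG: "g \<in> carrier G" using N g by (rule subgroup.mem_carrier)
    show ?thesis
    proof (cases "g \<in> H")
      case True then show ?thesis using coset_join2 gG H by blast
    next
      case False
      then have "g \<otimes> t \<in> H" using cov g by blast
      then have "H #> (g \<otimes> t) = H" using coset_join2 gG tG H by blast
      then have "H #> (g \<otimes> t \<otimes> inv t) = H #> inv t"
        using coset_mult_assoc[of H "g \<otimes> t" "inv t"] subgroup.subset[OF H] gG tG by simp
      then show ?thesis using gG tG by (simp add: m_assoc)
    qed
  qed
  then have "(\<lambda>g. H #> g) ` ?N \<subseteq> {H, H #> inv t}" by blast
  moreover have "H #> \<one> = H" using coset_mult_one subgroup.subset[OF H] by blast
  moreover have "\<one> \<in> ?N" by (rule subgroup.one_closed[OF N])
  ultimately have "(\<lambda>g. H #> g) ` ?N = {H, H #> inv t}" using it by blast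
  moreover have "rcosets\<^bsub>G\<lparr>carrier := ?N\<rparr>\<^esub> H = (\<lambda>g. H #> g) ` ?N"
    unfolding RCOSETS_def r_coset_def by simp blast
  moreover have "H \<noteq> H #> inv t"
  proof
    assume "H = H #> inv t"
    then have "inv t \<in> H" using rcos_self[of "inv t" H] H tG by auto
    then have "inv (inv t) \<in> H" using H by (rule subgroup.m_inv_closed[rotated])
    then show False using t(2) tG by simp
  qed
  ultimately show ?thesis by simp
qed

text \<open>Conjugation by \<open>c\<close> is an automorphism taking \<open>K\<close> to
  \<open>H\<close> and hence one normaliser to the other, so the index can be computed at a
  convenient conjugate. The preimage \<open>u\<close> of \<open>t\<close> is the witness for
  \<open>K\<close>.\<close>

lemma (in group) index_normalizer_conj:
  assumes K: "subgroup K G" and H: "subgroup H G" and c: "c \<in> carrier G"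
    and KH: "(\<lambda>k. inv c \<otimes> k \<otimes> c) ` K = H"
    and t: "t \<in> normalizer G H" "t \<notin> H"
    and cov: "\<And>g. g \<in> normalizer G H \<Longrightarrow> g \<in> H \<or> g \<otimes> t \<in> H"
  shows "card (rcosets\<^bsub>G\<lparr>carrier := normalizer G K\<rparr>\<^esub> K) = 2"
proof -
  define \<kappa> where "\<kappa> = (\<lambda>g. inv c \<otimes> g \<otimes> c)"
  have cancel: "c \<otimes> (inv c \<otimes> g) = g" "inv c \<otimes> (c \<otimes> g) = g" if "g \<in> carrier G" for g
    using that c by (simp_all add: m_assoc[symmetric])
  have \<kappa>_closed: "\<kappa> g \<in> carrier G" if "g \<in> carrier G" for g using that c by (simp add: \<kappa>_def)
  have \<kappa>_mult: "\<kappa> (g \<otimes> h) = \<kappa> g \<otimes> \<kappa> h" if "g \<in> carrier G" "h \<in> carrier G" for g h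
    using that c by (simp add: \<kappa>_def m_assoc cancel)
  have \<kappa>_inv: "\<kappa> (inv g) = inv (\<kappa> g)" if "g \<in> carrier G" for g
    using that c by (simp add: \<kappa>_def m_assoc inv_mult_group)
  have \<kappa>_inj: "g = h" if "\<kappa> g = \<kappa> h" "g \<in> carrier G" "h \<in> carrier G" for g h
    using that c by (simp add: \<kappa>_def)
  have KG: "K \<subseteq> carrier G" by (rule subgroup.subset[OF K])
  have mem: "g \<in> K \<longleftrightarrow> \<kappa> g \<in> H" if g: "g \<in> carrier G" for g
  proof
    assume "\<kappa> g \<in> H"
    then obtain k where "k \<in> K" "\<kappa> g = \<kappa> k" using KH unfolding \<kappa>_def by blast
    then show "g \<in> K" using \<kappa>_inj g KG by blast
  qed (use KH in \<open>auto simp: \<kappa>_def\<close>)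
  have norm: "\<kappa> g \<in> normalizer G H \<longleftrightarrow> g \<in> normalizer G K" if g: "g \<in> carrier G" for g
  proof -
    have *: "\<kappa> h \<otimes> \<kappa> s \<otimes> \<kappa> h' \<in> H \<longleftrightarrow> h \<otimes> s \<otimes> h' \<in> K"
      if "s \<in> K" "h \<in> carrier G" "h' \<in> carrier G" for s h h'
      using mem[of "h \<otimes> s \<otimes> h'"] that subsetD[OF KG that(1)] by (simp add: \<kappa>_mult)
    have ball: "(\<forall>s\<in>H. P s) \<longleftrightarrow> (\<forall>s\<in>K. P (\<kappa> s))" for P
      using KH unfolding \<kappa>_def by blast
    show ?thesis
      unfolding mem_normalizer_iff[OF H] mem_normalizer_iff[OF K] ball \<kappa>_inv[OF g, symmetric]
      using * g \<kappa>_closed[OF g] by simp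
  qed
  have tG: "t \<in> carrier G" using t(1) by (simp add: mem_normalizer_iff[OF H])
  define u where "u = c \<otimes> t \<otimes> inv c"
  have uG: "u \<in> carrier G" using c tG by (simp add: u_def)
  have \<kappa>u: "\<kappa> u = t" using c tG by (simp add: \<kappa>_def u_def m_assoc cancel)
  show ?thesis
  proof (rule index_normalizer_eq_2[OF K, of u])
    show "u \<in> normalizer G K" using norm[OF uG] \<kappa>u t(1) by simp
    show "u \<notin> K" using mem[OF uG] \<kappa>u t(2) by simp
  next
    fix g assume g: "g \<in> normalizer G K"
    then have gG: "g \<in> carrier G" by (simp add: mem_normalizer_iff[OF K])
    have "\<kappa> g \<in> H \<or> \<kappa> g \<otimes> t \<in> H" using norm[OF gG] g cov by blast
    then show "g \<in> K \<or> g \<otimes> u \<in> K"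
      using mem[OF gG] mem[of "g \<otimes> u"] gG uG \<kappa>u by (simp add: \<kappa>_mult)
  qed
qed

section \<open>The triangular affine group is a 2-group\<close>

text \<open>Each squaring fixes one more coordinate. If \<open>h\<close> fixes the first
  \<open>i\<close> coordinates, then \<open>x\<close> and \<open>h x\<close> agree there, so
  \<open>h\<close> treats coordinate \<open>i\<close> alike at both points, and two flips
  cancel.\<close>

lemma Tri_pow_agree:
  assumes f: "f \<in> Tri n" and x: "x \<in> Vn n"
  shows "agree i ((f [^]\<^bsub>SymV n\<^esub> (2 ^ i :: nat)) x) x"
  using x
proof (induction i arbitrary: x)
  case 0
  then show ?case by (simp add: agree_def)
next
  case (Suc i)
  let ?h = "f [^]\<^bsub>SymV n\<^esub> (2 ^ i :: nat)"
  interpret group "SymV n" by (rule group_BijGroup)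
  have hT: "?h \<in> Tri n"
    using subgroup.subgroup_is_group[OF subgroup_Tri group_BijGroup, of n]
      monoid.nat_pow_closed[of "SymV n\<lparr>carrier := Tri n\<rparr>" f] f
    by (simp add: group.is_monoid nat_pow_consistent[symmetric])
  then have hB: "?h \<in> Bij (Vn n)" by simp
  have "f [^]\<^bsub>SymV n\<^esub> (2 ^ Suc i :: nat) = ?h \<otimes>\<^bsub>SymV n\<^esub> ?h"
    using f by (simp add: nat_pow_mult mult_2)
  then have eq: "(f [^]\<^bsub>SymV n\<^esub> (2 ^ Suc i :: nat)) x = ?h (?h x)"
    using hB Suc.prems by simp
  have a: "agree i (?h x) x" "agree i (?h (?h x)) (?h x)"
    using Suc.IH hB Suc.prems by simp_all
  have "(?h (?h x) i = ?h x i) = (?h x i = x i)"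
    using Tri_coord[OF hT _ _ a(1)] hB Suc.prems by simp
  then show ?case unfolding eq agree_Suc using agree_trans[OF a(2,1)] by auto
qed

lemma finite_Bij: "finite (Bij (Vn n))"
proof (rule finite_subset)
  show "Bij (Vn n) \<subseteq> Vn n \<rightarrow>\<^sub>E Vn n" by (auto simp: PiE_def Bij_imp_extensional)
qed (simp add: finite_PiE)

text \<open>The \<open>2 ^ n\<close>-th power of a triangular map fixes all \<open>n\<close>
  coordinates, so the exponent of the group divides a power of two.\<close>

lemma card_Unitri: "\<exists>a. card (Unitri n) = 2 ^ a"
proof -
  let ?G = "SymV n\<lparr>carrier := Unitri n\<rparr>"
  interpret S: group "SymV n" by (rule group_BijGroup)
  interpret U: group ?G by (rule subgroup.subgroup_is_group[OF subgroup_Unitri group_BijGroup])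
  have "Unitri n \<subseteq> Bij (Vn n)" by auto
  then have fin: "finite (carrier ?G)" using finite_Bij finite_subset by auto
  have "f [^]\<^bsub>?G\<^esub> (2 ^ n :: nat) = \<one>\<^bsub>?G\<^esub>" if f: "f \<in> carrier ?G" for f
  proof -
    let ?h = "f [^]\<^bsub>SymV n\<^esub> (2 ^ n :: nat)"
    have fT: "f \<in> Tri n" using f by simp
    have hB: "?h \<in> Bij (Vn n)" using S.nat_pow_closed[of f] fT by simp
    have "?h = \<one>\<^bsub>SymV n\<^esub>"
    proof (rule Bij_eqI[OF hB one_Bij])
      fix x assume x: "x \<in> Vn n"
      show "?h x = \<one>\<^bsub>SymV n\<^esub> x"
        using Tri_pow_agree[OF fT x, of n] x hB agree_all_iff[of "?h x" n x] by simp
    qed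
    then show ?thesis by (simp add: S.nat_pow_consistent[symmetric])
  qed
  from U.order_prime_power[OF fin two_is_prime_nat this] show ?thesis by (simp add: order_def)
qed

section \<open>The normaliser of the triangular affine group\<close>

text \<open>For a bijection \<open>g\<close> this is one half of normalising, namely that
  conjugation by \<open>g\<close> maps \<open>Unitri n\<close> into itself, written without the
  inverse of \<open>g\<close>.\<close>

definition intertwines :: "nat \<Rightarrow> ((nat \<Rightarrow> bool) \<Rightarrow> (nat \<Rightarrow> bool)) \<Rightarrow> bool" where
  "intertwines n g \<longleftrightarrow> (\<forall>s\<in>Unitri n. \<exists>s'\<in>Unitri n. \<forall>x\<in>Vn n. g (s x) = s' (g x))"

text \<open>Let \<open>j\<close> be the first coordinate not vanishing on \<open>W\<close>, and
  \<open>u\<close> in \<open>W\<close> nonzero there. Shearing \<open>u\<close> along coordinate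
  \<open>j\<close> and subtracting \<open>u\<close> puts every later unit vector into
  \<open>W\<close>, which then fills \<open>tail_space n j\<close>.\<close>

lemma shear_invariant_subspace:
  assumes WV: "W \<subseteq> Vn n" and zero: "zero_vec \<in> W"
    and add: "\<And>x y. x \<in> W \<Longrightarrow> y \<in> W \<Longrightarrow> vadd x y \<in> W"
    and inv: "\<And>i k x. i < k \<Longrightarrow> k < n \<Longrightarrow> x \<in> W \<Longrightarrow> shear n k (\<lambda>x. x i) x \<in> W"
  shows "\<exists>j\<le>n. W = tail_space n j"
proof (cases "\<exists>i. \<exists>x\<in>W. x i")
  case False
  then have "x = zero_vec" if "x \<in> W" for x using that by (auto simp: zero_vec_def fun_eq_iff)
  then have "W = {zero_vec}" using zero by blast
  then show ?thesis by (metis tail_space_beyond le_refl)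
next
  case True
  define j where "j = (LEAST i. \<exists>x\<in>W. x i)"
  have "\<exists>x\<in>W. x j" unfolding j_def using True by (rule LeastI_ex)
  then obtain u where u: "u \<in> W" "u j" by blast
  have lead: "\<not> x i" if "x \<in> W" "i < j" for x i
    using not_less_Least[of i "\<lambda>i. \<exists>x\<in>W. x i"] that unfolding j_def by blast
  have uV: "u \<in> Vn n" using u WV by blast
  then have jn: "j < n" using u(2) unfolding Vn_def by (metis mem_Collect_eq not_le)
  have Wt: "W \<subseteq> tail_space n j" using WV lead by (auto simp: tail_space_def)
  have unit: "unit_vec k \<in> W" if "j < k" "k < n" for k
  proof -
    have "shear n k (\<lambda>x. x j) u = vadd u (unit_vec k)" using uV u(2) by (simp add: shear_coord_eq)
    then have "vadd u (vadd u (unit_vec k)) \<in> W" using add[OF u(1)] inv[OF that u(1)] by metis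
    then show ?thesis by simp
  qed
  \<comment> \<open>These vectors, one for each leading position from \<open>j\<close> on, form an
    echelon basis; clearing leading entries with them gives the inclusion of
    \<open>tail_space n j\<close> in \<open>W\<close>.\<close>
  have pivot: "\<exists>w\<in>W. w \<in> tail_space n m \<and> w m" if "j \<le> m" "m < n" for m
  proof (cases "m = j")
    case True
    then show ?thesis using u Wt by blast
  next
    case False
    then show ?thesis using unit[of m] that unit_vec_tail_space[of m n]
      by (auto simp: unit_vec_def)
  qed
  have "tail_space n m \<subseteq> W" if "j \<le> m" "m \<le> n" for m
    using that(2,1)
  proof (induction rule: inc_induct)
    case base
    then show ?case using zero by (simp add: tail_space_beyond)
  next
    case (step m)
    then have IH: "tail_space n (Suc m) \<subseteq> W" by simp
    obtain w where w: "w \<in> W" "w \<in> tail_space n m" "w m" using pivot step by blast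
    show ?case
    proof
      fix x assume x: "x \<in> tail_space n m"
      show "x \<in> W"
      proof (cases "x m")
        case True
        then have "vadd x w \<in> W" using tail_space_add_pivot[OF x w(2)] w(3) IH by blast
        then have "vadd (vadd x w) w \<in> W" using add w(1) by blast
        then show ?thesis by (simp add: vadd_assoc)
      next
        case False
        then show ?thesis using tail_space_SucI[OF x] IH by blast
      qed
    qed
  qed
  then have "tail_space n j \<subseteq> W" using jn by simp
  then show ?thesis using Wt jn by (metis less_imp_le subset_antisym)
qed

text \<open>The block system pulled back along \<open>g\<close> is again invariant under
  \<open>Unitri n\<close>, because \<open>s'\<close> preserves \<open>agree i\<close>.\<close>

lemma intertwines_agree:
  assumes g: "g \<in> Bij (Vn n)" and int: "intertwines n g"
    and s: "s \<in> Unitri n" and V: "x \<in> Vn n" "y \<in> Vn n" and a: "agree i (g x) (g y)"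
  shows "agree i (g (s x)) (g (s y))"
proof -
  obtain s' where s': "s' \<in> Unitri n" "\<And>x. x \<in> Vn n \<Longrightarrow> g (s x) = s' (g x)"
    using int s unfolding intertwines_def by blast
  then show ?thesis using V a g Tri_agree[of s' n "g x" "g y" i] by simp
qed

text \<open>Invariance under translations makes the pulled-back relation a congruence modulo a
  subspace \<open>W\<close>; invariance under shears puts \<open>W\<close> in the standard flag, and
  counting identifies which member it is.\<close>

lemma intertwines_Tri:
  assumes g: "g \<in> Bij (Vn n)" and int: "intertwines n g"
  shows "g \<in> Tri n"
proof (rule TriI[OF g])
  fix i x y assume V: "x \<in> Vn n" "y \<in> Vn n"
  show "agree i (g x) (g y) = agree i x y"
  proof (cases "i \<le> n")
    \<comment> \<open>Beyond \<open>n\<close> the relation is plain equality. This case is separate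
      because truncated subtraction in \<open>2 ^ (n - i)\<close> would not recover
      \<open>i\<close>.\<close>
    case False
    have "agree i u v \<longleftrightarrow> u = v" if "u \<in> Vn n" "v \<in> Vn n" for u v
    proof
      assume "agree i u v"
      then have "agree n u v" using False by (simp add: agree_def)
      then show "u = v" using that agree_all_iff by blast
    qed simp
    then show ?thesis using V g Bij_inj[OF g V] by simp
  next
    case True
    let ?E = "\<lambda>x y. agree i (g x) (g y)"
    have transl: "?E (vadd v x) (vadd v y)" if "?E x y" "x \<in> Vn n" "y \<in> Vn n" "v \<in> Vn n" for x y v
      using intertwines_agree[OF g int translation_Unitri[OF that(4)] that(2,3,1)] that by simp
    define W where "W = {x \<in> Vn n. ?E x zero_vec}"
    have "\<exists>j\<le>n. W = tail_space n j"
    proof (rule shear_invariant_subspace)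
      show "W \<subseteq> Vn n" "zero_vec \<in> W" by (auto simp: W_def)
      show "vadd x y \<in> W" if "x \<in> W" "y \<in> W" for x y
        using transl[of y zero_vec x] that agree_trans by (auto simp: W_def)
      show "shear n k (\<lambda>x. x i) x \<in> W" if "i < k" "k < n" "x \<in> W" for i k x
      proof -
        have s: "shear n k (\<lambda>x. x i) \<in> Unitri n" using that by (intro shear_coord_Unitri)
        have "shear n k (\<lambda>x. x i) zero_vec = zero_vec"
          by (simp add: shear_coord_eq) (simp add: zero_vec_def)
        then show ?thesis
          using intertwines_agree[OF g int s, of x zero_vec] that(3) s by (simp add: W_def)
      qed
    qed
    then obtain j where j: "j \<le> n" "W = tail_space n j" by blast
    \<comment> \<open>The \<open>g\<close>-image of the class of zero is a coset of
      \<open>tail_space n i\<close>. Comparing sizes then forces \<open>i = j\<close>.\<close>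
    have "(\<lambda>x. vadd (g x) (g zero_vec)) ` W = tail_space n i"
    proof (intro equalityI subsetI)
      fix y assume y: "y \<in> tail_space n i"
      let ?x = "(inv\<^bsub>SymV n\<^esub> g) (vadd y (g zero_vec))"
      have yV: "y \<in> Vn n" using y tail_space_subset by blast
      then have gx: "g ?x = vadd y (g zero_vec)" using g by simp
      have "agree i (g ?x) (g zero_vec)" unfolding gx
        using y g yV tail_space_iff[of "vadd y (g zero_vec)" n "g zero_vec" i] by (simp add: vadd_assoc)
      then have "?x \<in> W" using yV g by (simp add: W_def)
      moreover have "y = vadd (g ?x) (g zero_vec)" using gx by (simp add: vadd_assoc)
      ultimately show "y \<in> (\<lambda>x. vadd (g x) (g zero_vec)) ` W" by (rule rev_image_eqI[of ?x])
    qed (use g in \<open>auto simp: W_def tail_space_iff\<close>)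
    moreover have "inj_on (\<lambda>x. vadd (g x) (g zero_vec)) W"
      using Bij_inj[OF g] by (auto simp: inj_on_def W_def vadd_commute[of _ "g zero_vec"])
    ultimately have "card (tail_space n i) = card W" by (metis card_image)
    then have "(2::nat) ^ (n - i) = 2 ^ (n - j)" using j by (simp add: card_tail_space)
    then have "i = j" using j(1) True by simp
    have "?E x y \<longleftrightarrow> ?E (vadd x y) zero_vec"
    proof
      assume "?E x y"
      then show "?E (vadd x y) zero_vec" using transl[of x y y] V by (simp add: vadd_commute)
    next
      assume "?E (vadd x y) zero_vec"
      then show "?E x y" using transl[of "vadd x y" zero_vec y] V by (simp add: vadd_commute[of x])
    qed
    also have "\<dots> \<longleftrightarrow> vadd x y \<in> W" using V by (simp add: W_def)
    also have "\<dots> \<longleftrightarrow> agree i x y" using j(2) \<open>i = j\<close> V by (simp add: tail_space_iff)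
    finally show ?thesis .
  qed
qed

section \<open>Affinity of all coordinates but the last\<close>

text \<open>The shear adding coordinate \<open>i\<close> to the last one moves \<open>x\<close>
  exactly when \<open>x i\<close> holds, and triangularity of \<open>g\<close> makes this visible in
  the last coordinate of \<open>g x\<close>. So \<open>x i\<close>, as a function of
  \<open>z = g x\<close>, is the change of the last coordinate under the affine map
  \<open>s'\<close>.\<close>

lemma intertwines_inv_coord_affine:
  assumes g: "g \<in> Tri n" and int: "intertwines n g" and i: "Suc i < n"
  shows "affine_fun n (\<lambda>z. (inv\<^bsub>SymV n\<^esub> g) z i)"
proof -
  let ?s = "shear n (n - 1) (\<lambda>x. x i)"
  have s: "?s \<in> Unitri n" using i by (intro shear_coord_Unitri) auto
  obtain s' where s': "s' \<in> Unitri n" "\<And>x. x \<in> Vn n \<Longrightarrow> g (?s x) = s' (g x)"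
    using int s unfolding intertwines_def by blast
  have "affine_fun n (\<lambda>z. s' z (n - 1) \<noteq> z (n - 1))"
    using s'(1) by (intro affine_fun_xor affine_fun_coord AGL_affine) simp
  also have "affine_fun n (\<lambda>z. s' z (n - 1) \<noteq> z (n - 1)) \<longleftrightarrow> ?thesis"
  proof (rule affine_fun_cong)
    fix z assume z: "z \<in> Vn n"
    let ?x = "(inv\<^bsub>SymV n\<^esub> g) z"
    have x: "?x \<in> Vn n" "g ?x = z" using z g by simp_all
    have "agree (n - 1) (?s ?x) ?x" using x by (simp add: shear_apply agree_def)
    moreover have "?s ?x \<in> Vn n" using x s by simp
    ultimately have "(g (?s ?x) (n - 1) = g ?x (n - 1)) = (?s ?x (n - 1) = ?x (n - 1))"
      using Tri_coord[OF g] x(1) by blast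
    moreover have "(?s ?x (n - 1) = ?x (n - 1)) = (\<not> ?x i)"
      using x(1) by (auto simp: shear_apply)
    ultimately show "(s' z (n - 1) \<noteq> z (n - 1)) = ?x i"
      unfolding s'(2)[OF x(1)] x(2) by argo
  qed
  finally show ?thesis .
qed

section \<open>Invariant alternating forms and the degree of the last coordinate\<close>

text \<open>For \<open>k\<close> at least 2, a shear sending \<open>unit_vec i\<close> to its sum
  with \<open>unit_vec k\<close> and fixing \<open>unit_vec m\<close> forces the form to vanish on
  \<open>unit_vec k\<close>, \<open>unit_vec m\<close>. By symmetry only the pair of indices 0 and 1
  survives.\<close>

lemma invariant_bilinear_form:
  assumes n: "2 < n"
    and add: "\<And>u u' v. u \<in> Vn n \<Longrightarrow> u' \<in> Vn n \<Longrightarrow> v \<in> Vn n \<Longrightarrow> B (vadd u u') v = (B u v \<noteq> B u' v)"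
    and sym: "\<And>u v. B u v = B v u"
    and alt: "\<And>u. \<not> B u u"
    and inv: "\<And>i k u v. i < k \<Longrightarrow> k < n \<Longrightarrow> u \<in> Vn n \<Longrightarrow> v \<in> Vn n \<Longrightarrow>
      B (shear n k (\<lambda>x. x i) u) (shear n k (\<lambda>x. x i) v) = B u v"
    and V: "x \<in> Vn n" "y \<in> Vn n"
  shows "B x y = (B (unit_vec 0) (unit_vec 1) \<and> (x 0 \<and> y 1) \<noteq> (x 1 \<and> y 0))"
proof -
  let ?e = "unit_vec" and ?c = "B (unit_vec 0) (unit_vec 1)"
  have off: "\<not> B (?e k) (?e m)" if km: "k \<noteq> m" "2 \<le> k" "k < n" "m < n" for k m
  proof -
    \<comment> \<open>Both 0 and 1 lie below \<open>k\<close>, and at most one of them equals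
      \<open>m\<close>.\<close>
    obtain i :: nat where i: "i < 2" "i \<noteq> m" using that[of 0] that[of 1] by (cases "m = 0") simp_all
    have e: "?e i \<in> Vn n" "?e m \<in> Vn n" "?e k \<in> Vn n" using i km n by simp_all
    have "shear n k (\<lambda>x. x i) (?e i) = vadd (?e i) (?e k)" "shear n k (\<lambda>x. x i) (?e m) = ?e m"
      using i e by (simp_all add: shear_coord_eq) (simp_all add: unit_vec_def)
    then have "B (vadd (?e i) (?e k)) (?e m) = B (?e i) (?e m)"
      using inv[of i k "?e i" "?e m"] i km e by simp
    then show ?thesis using add[OF e(1,3,2)] by auto
  qed
  \<comment> \<open>The difference between \<open>B\<close> and the claimed form; it is biadditive,
    so it vanishes once it does so on pairs of unit vectors.\<close>
  define C where "C = (\<lambda>u v. B u v \<noteq> (?c \<and> (u 0 \<and> v 1) \<noteq> (u 1 \<and> v 0)))"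
  have units: "\<not> C (?e k) (?e m)" if "k < n" "m < n" for k m
  proof -
    consider "k = m" | "k \<noteq> m" "2 \<le> k" | "k \<noteq> m" "2 \<le> m" | "k = 0" "m = 1" | "k = 1" "m = 0"
      by linarith
    then show ?thesis
    proof cases
      case 1 then show ?thesis using alt by (auto simp: C_def unit_vec_def)
    next
      case 2 then show ?thesis using off[of k m] that by (auto simp: C_def unit_vec_def)
    next
      case 3 then show ?thesis using off[of m k] sym[of "?e k"] that by (auto simp: C_def unit_vec_def)
    next
      case 4 then show ?thesis by (simp add: C_def) (simp add: unit_vec_def)
    next
      case 5 then show ?thesis using sym[of "?e 1" "?e 0"] by (simp add: C_def) (simp add: unit_vec_def)
    qed
  qed
  have C_add1: "C (vadd u u') v = (C u v \<noteq> C u' v)" if "u \<in> Vn n" "u' \<in> Vn n" "v \<in> Vn n" for u u' v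
  proof -
    have "vadd u u' 0 = (u 0 \<noteq> u' 0)" "vadd u u' 1 = (u 1 \<noteq> u' 1)" by (simp_all add: vadd_def)
    then show ?thesis
      unfolding C_def add[OF that] by (cases ?c; cases "v 0"; cases "v 1") auto
  qed
  have C_sym: "C u v = C v u" for u v
    unfolding C_def sym[of u v] by (cases ?c; cases "u 0"; cases "u 1") auto
  have C_add2: "C v (vadd u u') = (C v u \<noteq> C v u')" if "u \<in> Vn n" "u' \<in> Vn n" "v \<in> Vn n" for u u' v
    using C_add1[OF that] by (simp only: C_sym[of v])
  have C_unit: "\<not> C (?e k) y" if "k < n" for k
    by (rule additive_zero_on_units[where F = "C (?e k)" and n = n]) (use that units C_add2 V in auto)
  have "\<not> C x y"
  proof (rule additive_zero_on_units[where F = "\<lambda>x. C x y" and n = n])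
    show "C (vadd u u') y = (C u y \<noteq> C u' y)" if "u \<in> Vn n" "u' \<in> Vn n" for u u'
      by (rule C_add1[OF that V(2)])
  qed (use C_unit V in blast)+
  then show ?thesis by (simp add: C_def)
qed

text \<open>Affine derivatives along translations make the polarisation \<open>B\<close> of
  \<open>q\<close> additive, those along shears make it invariant. Hence \<open>B\<close> is also
  the polarisation of \<open>c \<and> x 0 \<and> x 1\<close>, and subtracting that product leaves an
  affine function.\<close>

lemma affine_derivative_quadratic:
  assumes n: "2 < n" and d: "\<And>s. s \<in> Unitri n \<Longrightarrow> affine_fun n (\<lambda>x. q (s x) \<noteq> q x)"
  shows "\<exists>c. affine_fun n (\<lambda>x. q x \<noteq> (c \<and> x 0 \<and> x 1))"
proof -
  \<comment> \<open>The term \<open>q zero_vec\<close> compensates for the constant part of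
    \<open>q\<close>, so that \<open>B\<close> vanishes when one argument is zero.\<close>
  define B where "B = (\<lambda>u v. q (vadd u v) \<noteq> (q u \<noteq> (q v \<noteq> q zero_vec)))"
  have sym: "B u v = B v u" for u v
    unfolding B_def vadd_commute[of u] by argo
  have alt: "\<not> B u u" for u by (simp add: B_def) argo
  have add: "B (vadd u u') v = (B u v \<noteq> B u' v)" if "u \<in> Vn n" "u' \<in> Vn n" "v \<in> Vn n" for u u' v
  proof -
    have "affine_fun n (\<lambda>x. q (restrict (vadd v) (Vn n) x) \<noteq> q x)"
      by (rule d[OF translation_Unitri[OF that(3)]])
    from affine_funD[OF this that(1,2) zero_vec_Vn]
    have "(q (vadd v (vadd u u')) \<noteq> q (vadd u u')) =
      ((q (vadd v u) \<noteq> q u) \<noteq> ((q (vadd v u') \<noteq> q u') \<noteq> (q v \<noteq> q zero_vec)))"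
      using that by (simp only: restrict_apply' vadd_Vn zero_vec_Vn vadd_simps)
    then show ?thesis unfolding B_def vadd_commute[of _ v] by argo
  qed
  have inv: "B (shear n k (\<lambda>x. x i) u) (shear n k (\<lambda>x. x i) v) = B u v"
    if ik: "i < k" "k < n" and V: "u \<in> Vn n" "v \<in> Vn n" for i k u v
  proof -
    let ?s = "shear n k (\<lambda>x. x i)"
    have s: "?s \<in> Unitri n" using ik by (intro shear_coord_Unitri)
    have s0: "?s zero_vec = zero_vec" by (simp add: shear_coord_eq) (simp add: zero_vec_def)
    have "?s (vadd (vadd u v) zero_vec) = vadd (vadd (?s u) (?s v)) (?s zero_vec)"
      using s V by (intro AGL_vadd3[of _ n]) simp_all
    then have sv: "?s (vadd u v) = vadd (?s u) (?s v)" by (simp add: s0)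
    show ?thesis
      using affine_funD[OF d[OF s] V zero_vec_Vn] unfolding B_def vadd_simps s0 sv by argo
  qed
  define c where "c = B (unit_vec 0) (unit_vec 1)"
  have B: "B x y = (c \<and> (x 0 \<and> y 1) \<noteq> (x 1 \<and> y 0))" if "x \<in> Vn n" "y \<in> Vn n" for x y
    unfolding c_def by (rule invariant_bilinear_form[OF n add sym alt inv that])
  define r where "r = (\<lambda>x. q x \<noteq> (c \<and> x 0 \<and> x 1))"
  \<comment> \<open>The two polarisations cancel. The constant \<open>q zero_vec\<close> is also
    \<open>r zero_vec\<close>, since the product vanishes at the origin.\<close>
  have r2: "r (vadd x y) = (r x \<noteq> (r y \<noteq> q zero_vec))" if "x \<in> Vn n" "y \<in> Vn n" for x y
  proof -
    have "q (vadd x y) = ((c \<and> (x 0 \<and> y 1) \<noteq> (x 1 \<and> y 0)) \<noteq> (q x \<noteq> (q y \<noteq> q zero_vec)))"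
      using B[OF that] unfolding B_def by argo
    moreover have "vadd x y 0 = (x 0 \<noteq> y 0)" "vadd x y 1 = (x 1 \<noteq> y 1)" by (simp_all add: vadd_def)
    ultimately show ?thesis
      unfolding r_def by (cases c; cases "x 0"; cases "x 1"; cases "y 0"; cases "y 1") auto
  qed
  have "affine_fun n r"
  proof (rule affine_funI)
    fix x y z assume V: "x \<in> Vn n" "y \<in> Vn n" "z \<in> Vn n"
    show "r (vadd (vadd x y) z) = (r x \<noteq> (r y \<noteq> r z))"
      unfolding r2[OF vadd_Vn[OF V(1,2)] V(3)] r2[OF V(1,2)] by argo
  qed
  then show ?thesis unfolding r_def by blast
qed

lemma Unitri_by_coords:
  assumes f: "f \<in> Tri n" and low: "\<And>i. i < n - 1 \<Longrightarrow> affine_fun n (\<lambda>x. f x i)"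
    and last: "affine_fun n (\<lambda>x. f x (n - 1))"
  shows "f \<in> Unitri n"
proof (rule UnitriI[OF f])
  fix i
  consider "i < n - 1" | "i = n - 1" | "n \<le> i" by linarith
  then show "affine_fun n (\<lambda>x. f x i)"
  proof cases
    \<comment> \<open>Coordinates from \<open>n\<close> on are constantly \<open>False\<close> on
      \<open>Vn n\<close>, hence affine.\<close>
    case 3
    have "\<not> y i" if "y \<in> Vn n" for y using that 3 by (simp add: Vn_def)
    then have "f x i = False" if "x \<in> Vn n" for x using that f BijD[OF Tri_Bij[OF f] that] by blast
    then have "affine_fun n (\<lambda>x. f x i) = affine_fun n (\<lambda>x. False)" by (rule affine_fun_cong)
    then show ?thesis by (simp add: affine_fun_def)
  qed (use low last in simp_all)
qed

text \<open>The derivative equals \<open>a (g x)\<close>, where \<open>a\<close> is the change that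
  \<open>s'\<close> makes in the last coordinate. As \<open>a\<close> is affine and ignores the last
  coordinate, affinity of the other coordinates of \<open>g\<close> suffices.\<close>

lemma intertwines_last_coord_derivative:
  assumes n: "0 < n" and g: "g \<in> Tri n" and int: "intertwines n g"
    and aff: "\<And>i. Suc i < n \<Longrightarrow> affine_fun n (\<lambda>x. g x i)"
    and s: "s \<in> Unitri n"
  shows "affine_fun n (\<lambda>x. g (s x) (n - 1) \<noteq> g x (n - 1))"
proof -
  obtain s' where s': "s' \<in> Unitri n" "\<And>x. x \<in> Vn n \<Longrightarrow> g (s x) = s' (g x)"
    using int s unfolding intertwines_def by blast
  define a where "a = (\<lambda>z. s' z (n - 1) \<noteq> z (n - 1))"
  have a_aff: "affine_fun n a"
    unfolding a_def using s'(1) by (intro affine_fun_xor affine_fun_coord AGL_affine) simp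
  have a_cong: "a y = a z" if "y \<in> Vn n" "z \<in> Vn n" "agree (n - 1) y z" for y z
    using Tri_coord[OF UnitriD(1)[OF s'(1)] that] unfolding a_def by argo
  have gV: "g x \<in> Vn n" if "x \<in> Vn n" for x using g that by simp
  have "affine_fun n (\<lambda>x. a (g x))"
  proof (rule affine_funI)
    fix x y z assume V: "x \<in> Vn n" "y \<in> Vn n" "z \<in> Vn n"
    have "agree (n - 1) (g (vadd (vadd x y) z)) (vadd (vadd (g x) (g y)) (g z))"
      unfolding agree_def
    proof (intro allI impI)
      fix i assume "i < n - 1"
      then show "g (vadd (vadd x y) z) i = vadd (vadd (g x) (g y)) (g z) i"
        using affine_funD[OF aff V, of i] unfolding vadd_def[of _ "g z"] vadd_def[of "g x"] by auto
    qed
    then have "a (g (vadd (vadd x y) z)) = a (vadd (vadd (g x) (g y)) (g z))"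
      using V gV by (intro a_cong) simp_all
    then show "a (g (vadd (vadd x y) z)) = (a (g x) \<noteq> (a (g y) \<noteq> a (g z)))"
      using affine_funD[OF a_aff gV[OF V(1)] gV[OF V(2)] gV[OF V(3)]] by simp
  qed
  also have "affine_fun n (\<lambda>x. a (g x)) \<longleftrightarrow> ?thesis"
    by (rule affine_fun_cong) (simp add: a_def s'(2))
  finally show ?thesis .
qed

section \<open>The quadratic shear normalises the triangular affine group\<close>

definition quad_shear :: "nat \<Rightarrow> (nat \<Rightarrow> bool) \<Rightarrow> (nat \<Rightarrow> bool)" where
  "quad_shear n = shear n (n - 1) (\<lambda>x. x 0 \<and> x 1)"

text \<open>For \<open>n > 2\<close> the last index exceeds 1, so the product involves earlier
  coordinates only.\<close>

lemma quad_shear_Tri: "2 < n \<Longrightarrow> quad_shear n \<in> Tri n"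
  unfolding quad_shear_def by (rule shear_Tri) (simp_all add: agree_def)

lemma quad_shear_agree: "x \<in> Vn n \<Longrightarrow> agree (n - 1) (quad_shear n x) x"
  by (simp add: quad_shear_def shear_apply agree_def)

lemma quad_shear_last: "x \<in> Vn n \<Longrightarrow> quad_shear n x (n - 1) = (x (n - 1) \<noteq> (x 0 \<and> x 1))"
  by (simp add: quad_shear_def shear_apply)

text \<open>The classes of \<open>agree (n - 1)\<close> are pairs. \<open>quad_shear\<close> flips
  some of these pairs, and \<open>f\<close> maps pairs to pairs, so the flip reappears in the last
  coordinate of the image.\<close>

lemma Tri_quad_shear:
  assumes n: "2 < n" and f: "f \<in> Tri n" and x: "x \<in> Vn n"
  shows "i < n - 1 \<Longrightarrow> f (quad_shear n x) i = f x i"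
    and "f (quad_shear n x) (n - 1) = (f x (n - 1) \<noteq> (x 0 \<and> x 1))"
proof -
  have V: "quad_shear n x \<in> Vn n" using quad_shear_Tri[OF n] x by simp
  note a = quad_shear_agree[OF x]
  show "f (quad_shear n x) i = f x i" if "i < n - 1"
    using Tri_agree[OF f V x, of "n - 1"] a that by (simp add: agree_def)
  show "f (quad_shear n x) (n - 1) = (f x (n - 1) \<noteq> (x 0 \<and> x 1))"
    using Tri_coord[OF f V x a] quad_shear_last[OF x] by argo
qed

lemma quad_shear_involution:
  assumes n: "2 < n"
  shows "quad_shear n \<otimes>\<^bsub>SymV n\<^esub> quad_shear n = \<one>\<^bsub>SymV n\<^esub>"
proof (rule Bij_eqI)
  have B: "quad_shear n \<in> Bij (Vn n)" using quad_shear_Tri[OF n] by simp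
  then show "quad_shear n \<otimes>\<^bsub>SymV n\<^esub> quad_shear n \<in> Bij (Vn n)" by simp
  fix x assume x: "x \<in> Vn n"
  have V: "quad_shear n x \<in> Vn n" "quad_shear n (quad_shear n x) \<in> Vn n" using B x by simp_all
  have "agree (n - 1) (quad_shear n (quad_shear n x)) x"
    by (rule agree_trans[OF quad_shear_agree[OF V(1)] quad_shear_agree[OF x]])
  moreover have "quad_shear n (quad_shear n x) (n - 1) = x (n - 1)"
    using Tri_quad_shear(2)[OF n quad_shear_Tri[OF n] x] quad_shear_last[OF x] by argo
  ultimately have "agree (Suc (n - 1)) (quad_shear n (quad_shear n x)) x"
    unfolding agree_Suc by blast
  then have "quad_shear n (quad_shear n x) = x"
    using n agree_all_iff[OF V(2) x] by simp
  then show "(quad_shear n \<otimes>\<^bsub>SymV n\<^esub> quad_shear n) x = \<one>\<^bsub>SymV n\<^esub> x"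
    using B x by simp
qed simp

text \<open>The product \<open>x 0 \<and> x 1\<close> holds at the sum of the first two unit
  vectors, but at neither of them nor at zero.\<close>

lemma quad_shear_not_affine:
  assumes n: "2 < n"
  shows "quad_shear n \<notin> AGL n"
proof
  assume "quad_shear n \<in> AGL n"
  then have aff: "affine_fun n (\<lambda>x. quad_shear n x (n - 1))" by (rule AGL_affine)
  have V: "unit_vec 0 \<in> Vn n" "unit_vec 1 \<in> Vn n" using n by simp_all
  show False
    using affine_funD[OF aff V zero_vec_Vn] quad_shear_last[OF V(1)] quad_shear_last[OF V(2)]
      quad_shear_last[OF zero_vec_Vn] quad_shear_last[OF vadd_Vn[OF V]] n
    by (simp add: unit_vec_def vadd_def zero_vec_def)
qed

text \<open>Writing \<open>s\<close> on the first two coordinates as \<open>x\<^sub>0 + c\<close>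
  and \<open>x\<^sub>1 + a(x\<^sub>0)\<close>, the difference of the products is
  \<open>c x\<^sub>1\<close> plus a function of \<open>x\<^sub>0\<close> alone, and both summands
  are affine.\<close>

lemma affine_fun_triangular_product:
  assumes n: "2 < n" and s: "s \<in> Tri n"
  shows "affine_fun n (\<lambda>x. (s x 0 \<and> s x 1) \<noteq> (x 0 \<and> x 1))"
proof -
  \<comment> \<open>A representative with prescribed coordinate 0 and with coordinate 1 zero; the
    value of \<open>s\<close> there yields the term \<open>a(x\<^sub>0)\<close>.\<close>
  let ?b = "\<lambda>c. if c then unit_vec 0 else zero_vec"
  have bV: "?b c \<in> Vn n" for c using n by simp
  have s0: "s x 0 = (x 0 \<noteq> s zero_vec 0)" if "x \<in> Vn n" for x
  proof -
    have "(s x 0 = s zero_vec 0) = (x 0 = zero_vec 0)"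
      using that by (intro Tri_coord[OF s]) (simp_all add: agree_def)
    then show ?thesis by (auto simp: zero_vec_def)
  qed
  have s1: "s x 1 = (x 1 \<noteq> s (?b (x 0)) 1)" if "x \<in> Vn n" for x
  proof -
    have "(s x 1 = s (?b (x 0)) 1) = (x 1 = ?b (x 0) 1)"
      using that bV[of "x 0"] by (intro Tri_coord[OF s]) (auto simp: agree_def zero_vec_def unit_vec_def)
    then show ?thesis by (auto simp: zero_vec_def unit_vec_def split: if_splits)
  qed
  let ?c = "s zero_vec 0" and ?a = "\<lambda>c. s (?b c) 1"
  have "affine_fun n (\<lambda>x. if ?c then x 1 else False)"
    by (cases ?c) (simp_all add: affine_fun_coord affine_fun_def)
  then have "affine_fun n (\<lambda>x. (if ?c then x 1 else False) \<noteq> ((x 0 \<noteq> ?c) \<and> ?a (x 0)))"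
    by (rule affine_fun_xor) (rule affine_fun_comp_coord)
  also have "affine_fun n (\<lambda>x. (if ?c then x 1 else False) \<noteq> ((x 0 \<noteq> ?c) \<and> ?a (x 0))) \<longleftrightarrow> ?thesis"
  proof (rule affine_fun_cong)
    fix x assume x: "x \<in> Vn n"
    show "((if ?c then x 1 else False) \<noteq> ((x 0 \<noteq> ?c) \<and> ?a (x 0))) =
      ((s x 0 \<and> s x 1) \<noteq> (x 0 \<and> x 1))"
      unfolding s0[OF x] s1[OF x] by (cases ?c; cases "x 1"; cases "x 0") simp_all
  qed
  finally show ?thesis .
qed

text \<open>\<open>quad_shear\<close> is its own inverse, so this is a conjugate of
  \<open>s\<close>. It differs from \<open>s\<close> only in the last coordinate, by the sum of the
  product of coordinates 0 and 1 before and after \<open>s\<close>, which is affine.\<close>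

lemma quad_shear_conj:
  assumes n: "2 < n" and s: "s \<in> Unitri n"
  shows "quad_shear n \<otimes>\<^bsub>SymV n\<^esub> s \<otimes>\<^bsub>SymV n\<^esub> quad_shear n \<in> Unitri n" (is "?f \<in> _")
proof (rule Unitri_by_coords)
  have T: "quad_shear n \<in> Tri n" "s \<in> Tri n" using n s quad_shear_Tri by simp_all
  then show "?f \<in> Tri n" using subgroup.m_closed[OF subgroup_Tri] by blast
  have fx: "?f x = quad_shear n (s (quad_shear n x))" if "x \<in> Vn n" for x using T that by simp
  have V: "s (quad_shear n x) \<in> Vn n" if "x \<in> Vn n" for x using T that by simp
  have s_aff: "affine_fun n (\<lambda>x. s x i)" for i using s by (simp add: AGL_affine)
  show "affine_fun n (\<lambda>x. ?f x i)" if i: "i < n - 1" for i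
  proof -
    have "affine_fun n (\<lambda>x. s x i) = affine_fun n (\<lambda>x. ?f x i)"
    proof (rule affine_fun_cong)
      fix x assume x: "x \<in> Vn n"
      show "s x i = ?f x i"
        using quad_shear_agree[OF V[OF x]] Tri_quad_shear(1)[OF n T(2) x i] i
        unfolding fx[OF x] by (simp add: agree_def)
    qed
    then show ?thesis using s_aff by blast
  qed
  have "affine_fun n (\<lambda>x. s x (n - 1) \<noteq> ((s x 0 \<and> s x 1) \<noteq> (x 0 \<and> x 1)))"
    by (rule affine_fun_xor[OF s_aff affine_fun_triangular_product[OF n T(2)]])
  moreover have "affine_fun n (\<lambda>x. s x (n - 1) \<noteq> ((s x 0 \<and> s x 1) \<noteq> (x 0 \<and> x 1))) =
    affine_fun n (\<lambda>x. ?f x (n - 1))"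
  proof (rule affine_fun_cong)
    fix x assume x: "x \<in> Vn n"
    have s01: "s (quad_shear n x) 0 = s x 0" "s (quad_shear n x) 1 = s x 1"
      using Tri_quad_shear(1)[OF n T(2) x] n by simp_all
    show "(s x (n - 1) \<noteq> ((s x 0 \<and> s x 1) \<noteq> (x 0 \<and> x 1))) = ?f x (n - 1)"
      using Tri_quad_shear(2)[OF n T(2) x] quad_shear_last[OF V[OF x]]
      unfolding fx[OF x] s01 by argo
  qed
  ultimately show "affine_fun n (\<lambda>x. ?f x (n - 1))" by blast
qed

section \<open>Determination of the normaliser\<close>

text \<open>The coefficient \<open>c\<close> of the quadratic term of the last coordinate decides
  between the alternatives: composing with \<open>quad_shear\<close> cancels that term.\<close>

lemma intertwines_cases:
  assumes n: "2 < n" and gB: "g \<in> Bij (Vn n)" and int: "intertwines n g"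
    and int': "intertwines n (inv\<^bsub>SymV n\<^esub> g)"
  shows "g \<in> Unitri n \<or> g \<otimes>\<^bsub>SymV n\<^esub> quad_shear n \<in> Unitri n"
proof -
  have g: "g \<in> Tri n" by (rule intertwines_Tri[OF gB int])
  have q: "quad_shear n \<in> Tri n" by (rule quad_shear_Tri[OF n])
  have "inv\<^bsub>SymV n\<^esub> g \<in> Tri n" by (rule subgroup.m_inv_closed[OF subgroup_Tri g])
  \<comment> \<open>The affinity lemma speaks about the inverse of its argument, so it is applied to
    the inverse of \<open>g\<close>.\<close>
  then have aff: "affine_fun n (\<lambda>x. g x i)" if "Suc i < n" for i
    using intertwines_inv_coord_affine[OF _ int' that] group.inv_inv[OF group_BijGroup, of g "Vn n"] gB
    by simp
  have "0 < n" using n by simp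
  from affine_derivative_quadratic[OF n intertwines_last_coord_derivative[OF this g int aff]]
  obtain c where c: "affine_fun n (\<lambda>x. g x (n - 1) \<noteq> (c \<and> x 0 \<and> x 1))" by blast
  show ?thesis
  proof (cases c)
    case False
    then have "affine_fun n (\<lambda>x. g x (n - 1))" using c by simp
    then have "g \<in> Unitri n" using aff by (intro Unitri_by_coords[OF g]) simp_all
    then show ?thesis by blast
  next
    case True
    let ?f = "g \<otimes>\<^bsub>SymV n\<^esub> quad_shear n"
    have fx: "?f x = g (quad_shear n x)" if "x \<in> Vn n" for x using g q that by simp
    have "?f \<in> Unitri n"
    proof (rule Unitri_by_coords)
      show "?f \<in> Tri n" using subgroup.m_closed[OF subgroup_Tri] g q by blast
      show "affine_fun n (\<lambda>x. ?f x i)" if i: "i < n - 1" for i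
      proof -
        have "affine_fun n (\<lambda>x. ?f x i) = affine_fun n (\<lambda>x. g x i)"
          by (rule affine_fun_cong) (simp only: fx Tri_quad_shear(1)[OF n g _ i])
        then show ?thesis using aff i by simp
      qed
      have "affine_fun n (\<lambda>x. ?f x (n - 1)) = affine_fun n (\<lambda>x. g x (n - 1) \<noteq> (c \<and> x 0 \<and> x 1))"
      proof (rule affine_fun_cong)
        fix x assume x: "x \<in> Vn n"
        show "?f x (n - 1) = (g x (n - 1) \<noteq> (c \<and> x 0 \<and> x 1))"
          using Tri_quad_shear(2)[OF n g x] True unfolding fx[OF x] by argo
      qed
      then show "affine_fun n (\<lambda>x. ?f x (n - 1))" using c by blast
    qed
    then show ?thesis by blast
  qed
qed

lemma normalizer_Unitri:
  assumes n: "2 < n"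
  shows "quad_shear n \<in> normalizer (SymV n) (Unitri n)"
    and "g \<in> normalizer (SymV n) (Unitri n) \<Longrightarrow>
      g \<in> Unitri n \<or> g \<otimes>\<^bsub>SymV n\<^esub> quad_shear n \<in> Unitri n"
proof -
  interpret group "SymV n" by (rule group_BijGroup)
  let ?t = "quad_shear n"
  have tB: "?t \<in> Bij (Vn n)" using quad_shear_Tri[OF n] by simp
  have it: "inv\<^bsub>SymV n\<^esub> ?t = ?t"
    using inv_equality[OF quad_shear_involution[OF n]] tB by simp
  show "?t \<in> normalizer (SymV n) (Unitri n)"
    using tB quad_shear_conj[OF n] by (simp add: mem_normalizer_iff[OF subgroup_Unitri] it)
  have int: "intertwines n h"
    if h: "h \<in> Bij (Vn n)" "\<And>s. s \<in> Unitri n \<Longrightarrow> h \<otimes>\<^bsub>SymV n\<^esub> s \<otimes>\<^bsub>SymV n\<^esub> inv\<^bsub>SymV n\<^esub> h \<in> Unitri n" for h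
    unfolding intertwines_def
  proof
    fix s assume s: "s \<in> Unitri n"
    have "h (s x) = (h \<otimes>\<^bsub>SymV n\<^esub> s \<otimes>\<^bsub>SymV n\<^esub> inv\<^bsub>SymV n\<^esub> h) (h x)" if "x \<in> Vn n" for x
      using h(1) s that by simp
    then show "\<exists>s'\<in>Unitri n. \<forall>x\<in>Vn n. h (s x) = s' (h x)" using h(2)[OF s] by blast
  qed
  assume g: "g \<in> normalizer (SymV n) (Unitri n)"
  have gB: "g \<in> Bij (Vn n)" using g by (simp add: mem_normalizer_iff[OF subgroup_Unitri])
  show "g \<in> Unitri n \<or> g \<otimes>\<^bsub>SymV n\<^esub> ?t \<in> Unitri n"
    using g gB by (intro intertwines_cases[OF n] int) (simp_all add: mem_normalizer_iff[OF subgroup_Unitri])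
qed

section \<open>Invariant flags\<close>

lemma mem_coset_iff: "x \<in> vadd w ` W \<longleftrightarrow> vadd w x \<in> W"
  by (metis image_iff vadd_simps(4))

text \<open>The cosets, each of size \<open>2 ^ k\<close>, partition the
  \<open>2 ^ n - 2 ^ k\<close> vectors outside \<open>W\<close>; so there are
  \<open>2 ^ (n - k) - 1\<close> of them.\<close>

lemma odd_card_nonzero_cosets:
  assumes WV: "W \<subseteq> Vn n" and add: "\<And>x y. x \<in> W \<Longrightarrow> y \<in> W \<Longrightarrow> vadd x y \<in> W"
    and card: "card W = 2 ^ k" and k: "k < n"
  shows "odd (card ((\<lambda>w. vadd w ` W) ` (Vn n - W)))" (is "odd (card ?E)")
proof -
  have W0: "W \<noteq> {}" using card by auto
  then obtain x where "x \<in> W" by blast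
  then have zero: "zero_vec \<in> W" using add[of x x] by simp
  note mem = mem_coset_iff
  have Un: "\<Union>?E = Vn n - W"
  proof (intro equalityI subsetI)
    fix x assume "x \<in> \<Union>?E"
    then obtain w where w: "w \<in> Vn n" "w \<notin> W" "vadd w x \<in> W" using mem by auto
    then have "x \<in> Vn n" using vadd_Vn[of w n "vadd w x"] WV by auto
    moreover have "x \<notin> W" using add[OF w(3)] w(2) by (metis vadd_simps(5))
    ultimately show "x \<in> Vn n - W" by blast
  next
    fix x assume "x \<in> Vn n - W"
    moreover have "x \<in> vadd x ` W" using zero by (simp add: mem)
    ultimately show "x \<in> \<Union>?E" by blast
  qed
  have disj: "C1 \<inter> C2 = {}" if C: "C1 \<in> ?E" "C2 \<in> ?E" "C1 \<noteq> C2" for C1 C2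
  proof (rule ccontr)
    assume "C1 \<inter> C2 \<noteq> {}"
    then obtain x where x: "x \<in> C1" "x \<in> C2" by blast
    obtain v w where vw: "C1 = vadd v ` W" "C2 = vadd w ` W" using C by blast
    then have "vadd v x \<in> W" "vadd w x \<in> W" using x mem by blast+
    then have d: "vadd v w \<in> W" using add[of "vadd v x" "vadd w x"]
      by (metis vadd_assoc vadd_commute vadd_simps(4))
    have "vadd v y \<in> W \<longleftrightarrow> vadd w y \<in> W" for y
      using add[OF d, of "vadd v y"] add[OF d, of "vadd w y"]
      by (metis vadd_assoc vadd_commute vadd_simps(4))
    then have "C1 = C2" unfolding vw set_eq_iff mem by blast
    then show False using C(3) by blast
  qed
  have "card W * card ?E = card (\<Union>?E)"
  proof (rule card_partition)
    show "finite (\<Union>?E)" unfolding Un by simp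
    show "finite ?E" by simp
    show "card C = card W" if C: "C \<in> ?E" for C
    proof -
      obtain w where "C = vadd w ` W" using C by blast
      then show ?thesis by (simp add: card_image inj_on_def)
    qed
  qed (rule disj)
  also have "\<dots> = 2 ^ n - 2 ^ k"
    unfolding Un using WV finite_subset[OF WV] by (simp add: card_Diff_subset card card_Vn)
  also have "\<dots> = 2 ^ k * (2 ^ (n - k) - 1)"
    using k by (simp add: diff_mult_distrib2 power_add[symmetric])
  finally have "card ?E = 2 ^ (n - k) - 1" by (simp add: card)
  then show ?thesis using k by simp
qed

text \<open>The linear parts of the elements of \<open>\<Sigma>\<close> permute the nonzero cosets
  of \<open>W\<close>. A group of order \<open>2 ^ a\<close> acting on an odd number of points fixes
  one.\<close>

lemma invariant_coset:
  assumes S: "subgroup \<Sigma> (SymV n)" and SA: "\<Sigma> \<subseteq> AGL n" and cS: "card \<Sigma> = 2 ^ a"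
    and WV: "W \<subseteq> Vn n" and add: "\<And>x y. x \<in> W \<Longrightarrow> y \<in> W \<Longrightarrow> vadd x y \<in> W"
    and cW: "card W = 2 ^ k" and k: "k < n"
    and inv: "\<And>f x y. f \<in> \<Sigma> \<Longrightarrow> x \<in> Vn n \<Longrightarrow> y \<in> Vn n \<Longrightarrow> vadd x y \<in> W \<Longrightarrow> vadd (f x) (f y) \<in> W"
  shows "\<exists>w\<in>Vn n - W. \<forall>f\<in>\<Sigma>. vadd w (vadd (f w) (f zero_vec)) \<in> W"
proof -
  let ?E = "(\<lambda>w. vadd w ` W) ` (Vn n - W)"
  let ?G = "SymV n\<lparr>carrier := \<Sigma>\<rparr>"
  \<comment> \<open>The linear part of \<open>f\<close>. It is multiplicative in \<open>f\<close>
    because \<open>f\<close> is affine, which is what makes \<open>\<phi>\<close> an action.\<close>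
  define L where "L = (\<lambda>f x. vadd (f x) (f zero_vec))"
  define \<phi> where "\<phi> = (\<lambda>f. \<lambda>C\<in>?E. L f ` C)"
  interpret G: group ?G by (rule subgroup.subgroup_is_group[OF S group_BijGroup])
  have fB: "f \<in> Bij (Vn n)" if "f \<in> \<Sigma>" for f using that SA by auto
  \<comment> \<open>The converse comes from applying \<open>inv\<close> to the inverse of
    \<open>f\<close>, which again lies in \<open>\<Sigma>\<close>.\<close>
  have iff: "vadd (f x) (f y) \<in> W \<longleftrightarrow> vadd x y \<in> W" if f: "f \<in> \<Sigma>" and V: "x \<in> Vn n" "y \<in> Vn n" for f x y
    using inv[OF f V] inv[OF subgroup.m_inv_closed[OF S f], of "f x" "f y"] V fB[OF f] by auto
  have LV: "L f x \<in> Vn n" if "f \<in> \<Sigma>" "x \<in> Vn n" for f x using that fB by (simp add: L_def)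
  have Linj: "inj_on (L f) (Vn n)" if "f \<in> \<Sigma>" for f
    using Bij_inj[OF fB[OF that]] by (simp add: inj_on_def L_def vadd_commute[of _ "f zero_vec"])
  have Lmult: "L (f \<otimes>\<^bsub>SymV n\<^esub> g) x = L f (L g x)" if "f \<in> \<Sigma>" "g \<in> \<Sigma>" "x \<in> Vn n" for f g x
  proof -
    have fA: "f \<in> AGL n" using that SA by blast
    have V: "g x \<in> Vn n" "g zero_vec \<in> Vn n" using that fB by simp_all
    have "f (vadd (g x) (g zero_vec)) = vadd (vadd (f (g x)) (f (g zero_vec))) (f zero_vec)"
      using AGL_vadd3[OF fA V zero_vec_Vn] by simp
    then show ?thesis using that fB by (simp add: L_def)
  qed
  note mem = mem_coset_iff
  \<comment> \<open>Both sides have \<open>card W\<close> elements, so one inclusion is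
    enough.\<close>
  have Lcoset: "L f ` (vadd w ` W) = vadd (L f w) ` W" if f: "f \<in> \<Sigma>" and w: "w \<in> Vn n" for f w
  proof (rule card_subset_eq)
    have WV': "vadd w ` W \<subseteq> Vn n" using w WV by auto
    have "inj_on (L f) (vadd w ` W)" by (rule inj_on_subset[OF Linj[OF f] WV'])
    moreover have "card (vadd v ` W) = card W" for v by (simp add: card_image inj_on_def)
    ultimately show "card (L f ` (vadd w ` W)) = card (vadd (L f w) ` W)" by (simp add: card_image)
    show "finite (vadd (L f w) ` W)" using finite_subset[OF WV] by simp
    show "L f ` (vadd w ` W) \<subseteq> vadd (L f w) ` W"
    proof
      fix y assume "y \<in> L f ` (vadd w ` W)"
      then obtain x where x: "x \<in> vadd w ` W" "y = L f x" by blast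
      then have "vadd (f w) (f x) \<in> W" using iff[OF f w, of x] WV' mem by blast
      moreover have "vadd (L f w) y = vadd (f w) (f x)"
        unfolding x(2) L_def by (metis vadd_assoc vadd_commute vadd_simps(4))
      ultimately show "y \<in> vadd (L f w) ` W" by (simp add: mem)
    qed
  qed
  have Lnot: "L f w \<in> Vn n - W" if "f \<in> \<Sigma>" "w \<in> Vn n - W" for f w
    using iff[OF that(1), of w zero_vec] LV[OF that(1), of w] that(2) by (simp add: L_def)
  have closed: "L f ` C \<in> ?E" if f: "f \<in> \<Sigma>" and C: "C \<in> ?E" for f C
  proof -
    obtain w where w: "w \<in> Vn n - W" "C = vadd w ` W" using C by blast
    then show ?thesis using Lcoset[OF f, of w] Lnot[OF f w(1)] by simp
  qed
  have EV: "C \<subseteq> Vn n" if C: "C \<in> ?E" for C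
  proof -
    obtain w where w: "w \<in> Vn n" "C = vadd w ` W" using C by blast
    show ?thesis unfolding w(2) using w(1) WV by (intro image_subsetI) (simp add: subset_iff)
  qed
  have bij: "\<phi> f \<in> Bij ?E" if f: "f \<in> \<Sigma>" for f
  proof -
    have inj: "inj_on (image (L f)) ?E"
    proof (rule inj_onI)
      fix C D assume "C \<in> ?E" "D \<in> ?E" "L f ` C = L f ` D"
      then show "C = D" using inj_on_image_eq_iff[OF Linj[OF f] EV EV, of C D] by simp
    qed
    have "image (L f) ` ?E = ?E"
      by (rule endo_inj_surj[OF _ image_subsetI inj]) (simp, rule closed[OF f])
    then have "bij_betw (image (L f)) ?E ?E" using inj by (simp add: bij_betw_def)
    then show ?thesis unfolding Bij_def \<phi>_def by simp
  qed
  have "group_action ?G ?E \<phi>"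
    unfolding group_action_def group_hom_def group_hom_axioms_def
  proof (intro conjI G.is_group group_BijGroup)
    show "\<phi> \<in> hom ?G (BijGroup ?E)"
    proof (rule homI)
      show "\<phi> f \<in> carrier (BijGroup ?E)" if "f \<in> carrier ?G" for f
        using bij that by (simp add: BijGroup_def)
      fix f g assume "f \<in> carrier ?G" "g \<in> carrier ?G"
      then have fg: "f \<in> \<Sigma>" "g \<in> \<Sigma>" by simp_all
      have "\<phi> (f \<otimes>\<^bsub>SymV n\<^esub> g) = compose ?E (\<phi> f) (\<phi> g)"
      proof (rule extensionalityI)
        show "\<phi> (f \<otimes>\<^bsub>SymV n\<^esub> g) \<in> extensional ?E" by (simp add: \<phi>_def)
        show "compose ?E (\<phi> f) (\<phi> g) \<in> extensional ?E" by simp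
        fix C assume C: "C \<in> ?E"
        have "L (f \<otimes>\<^bsub>SymV n\<^esub> g) ` C = L f ` (L g ` C)"
          unfolding image_image using Lmult[OF fg] EV[OF C] by (intro image_cong) auto
        then show "\<phi> (f \<otimes>\<^bsub>SymV n\<^esub> g) C = compose ?E (\<phi> f) (\<phi> g) C"
          using C closed[OF fg(2) C] by (simp only: \<phi>_def compose_def restrict_apply')
      qed
      then show "\<phi> (f \<otimes>\<^bsub>?G\<^esub> g) = \<phi> f \<otimes>\<^bsub>BijGroup ?E\<^esub> \<phi> g"
        using bij fg by (simp add: BijGroup_def)
    qed
  qed
  then have "\<exists>C\<in>?E. \<forall>f\<in>carrier ?G. \<phi> f C = C"
    using odd_card_nonzero_cosets[OF WV add cW k] cS
    by (intro group_action.prime_power_fixed_point[OF _ _ _ two_is_prime_nat]) (simp_all add: order_def)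
  then obtain C where C: "C \<in> ?E" "\<And>f. f \<in> \<Sigma> \<Longrightarrow> \<phi> f C = C" by auto
  obtain w where w: "w \<in> Vn n - W" "C = vadd w ` W" using C(1) by blast
  have "vadd w (L f w) \<in> W" if f: "f \<in> \<Sigma>" for f
  proof -
    have "zero_vec \<in> W" using add cW by (metis card.empty ex_in_conv power_eq_0_iff vadd_simps(1) zero_neq_numeral)
    then have "w \<in> C" unfolding w(2) mem by simp
    then have "L f w \<in> L f ` C" by (rule imageI)
    also have "L f ` C = C" using C(2)[OF f] C(1) by (simp only: \<phi>_def restrict_apply')
    finally show ?thesis unfolding w(2) mem .
  qed
  then show ?thesis using w(1) unfolding L_def by blast
qed

text \<open>A partial flag of invariant directions, encoded by a linear embedding \<open>m\<close>
  whose images of the standard members are those of the flag. At \<open>t = 0\<close> it is a full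
  flag together with a basis adapted to it.\<close>

definition invariant_flag_map where
  "invariant_flag_map n \<Sigma> t m \<longleftrightarrow> (\<forall>x\<in>tail_space n t. m x \<in> Vn n) \<and>
    (\<forall>x\<in>tail_space n t. \<forall>y\<in>tail_space n t. m (vadd x y) = vadd (m x) (m y)) \<and>
    inj_on m (tail_space n t) \<and>
    (\<forall>j\<ge>t. \<forall>f\<in>\<Sigma>. \<forall>x\<in>Vn n. \<forall>y\<in>Vn n.
      vadd x y \<in> m ` tail_space n j \<longrightarrow> vadd (f x) (f y) \<in> m ` tail_space n j)"

lemma invariant_flag_mapD:
  assumes "invariant_flag_map n \<Sigma> t m"
  shows "x \<in> tail_space n t \<Longrightarrow> m x \<in> Vn n"
    and "x \<in> tail_space n t \<Longrightarrow> y \<in> tail_space n t \<Longrightarrow> m (vadd x y) = vadd (m x) (m y)"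
    and "inj_on m (tail_space n t)"
    and "t \<le> j \<Longrightarrow> f \<in> \<Sigma> \<Longrightarrow> x \<in> Vn n \<Longrightarrow> y \<in> Vn n \<Longrightarrow>
      vadd x y \<in> m ` tail_space n j \<Longrightarrow> vadd (f x) (f y) \<in> m ` tail_space n j"
  using assms by (simp_all add: invariant_flag_map_def)

text \<open>The flag grows from zero upwards, with \<open>t\<close> descending from
  \<open>n\<close>. While its largest member \<open>W\<close> is proper, \<open>\<Sigma>\<close>
  fixes a nonzero coset of \<open>W\<close>, and a representative spans the next member together
  with \<open>W\<close>.\<close>

lemma invariant_flag_map_exists:
  assumes S: "subgroup \<Sigma> (SymV n)" and SA: "\<Sigma> \<subseteq> AGL n" and cS: "card \<Sigma> = 2 ^ a"
    and "t \<le> n"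
  shows "\<exists>m. invariant_flag_map n \<Sigma> t m"
  using assms(4)
proof (induction rule: inc_induct)
  case base
  have "vadd (f x) (f y) \<in> (\<lambda>_. zero_vec) ` tail_space n j"
    if "vadd x y \<in> (\<lambda>_. zero_vec) ` tail_space n j" "n \<le> j" for f x y j
    using that by (simp add: tail_space_beyond vadd_eq_zero)
  then show ?case
    by (intro exI[of _ "\<lambda>_. zero_vec"]) (simp add: invariant_flag_map_def tail_space_beyond)
next
  case (step t)
  let ?T = "tail_space n" and ?e = "unit_vec t"
  obtain m where m: "invariant_flag_map n \<Sigma> (Suc t) m" using step.IH by blast
  note mV = invariant_flag_mapD(1)[OF m] and madd = invariant_flag_mapD(2)[OF m]
    and minj = invariant_flag_mapD(3)[OF m] and minv = invariant_flag_mapD(4)[OF m]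
  let ?W = "m ` ?T (Suc t)"
  have m0: "m zero_vec = zero_vec"
    using madd[OF zero_tail_space zero_tail_space] by simp
  have Wadd: "vadd x y \<in> ?W" if xy: "x \<in> ?W" "y \<in> ?W" for x y
  proof -
    obtain u v where "u \<in> ?T (Suc t)" "x = m u" "v \<in> ?T (Suc t)" "y = m v" using xy by blast
    then show ?thesis using madd[of u v] tail_space_vadd[of u n "Suc t" v] by (metis imageI)
  qed
  have "card ?W = 2 ^ (n - Suc t)" using card_image[OF minj] by (simp add: card_tail_space)
  then have "\<exists>w\<in>Vn n - ?W. \<forall>f\<in>\<Sigma>. vadd w (vadd (f w) (f zero_vec)) \<in> ?W"
    using step.hyps mV Wadd minv[OF le_refl]
    by (intro invariant_coset[OF S SA cS, where k = "n - Suc t"]) auto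
  then obtain w where w: "w \<in> Vn n" "w \<notin> ?W" "\<And>f. f \<in> \<Sigma> \<Longrightarrow> vadd w (vadd (f w) (f zero_vec)) \<in> ?W"
    by blast
  \<comment> \<open>The linear extension of \<open>m\<close> that sends \<open>unit_vec t\<close> to
    the new direction \<open>w\<close>.\<close>
  define m' where "m' = (\<lambda>x. if x t then vadd (m (vadd x ?e)) w else m x)"
  have e: "?e \<in> ?T t" "?e t" using unit_vec_tail_space[of t n] step.hyps by (simp_all add: unit_vec_def)
  have low: "vadd x ?e \<in> ?T (Suc t)" if "x \<in> ?T t" "x t" for x
    using tail_space_add_pivot[OF that(1) e(1) that(2) e(2)] .
  have high: "x \<in> ?T (Suc t)" if "x \<in> ?T t" "\<not> x t" for x
    using tail_space_SucI that by blast
  have agr: "m' x = m x" if "x \<in> ?T j" "Suc t \<le> j" for x j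
    using that by (simp add: m'_def tail_space_def)
  then have img: "m' ` ?T j = m ` ?T j" if "Suc t \<le> j" for j
    using that by (intro image_cong) auto
  have m'V: "m' x \<in> Vn n" if "x \<in> ?T t" for x
    using mV low high w(1) that by (cases "x t") (simp_all add: m'_def)
  have vt: "vadd x y t = (x t \<noteq> y t)" for x y by (simp add: vadd_def)
  have m'add: "m' (vadd x y) = vadd (m' x) (m' y)" if xy: "x \<in> ?T t" "y \<in> ?T t" for x y
  proof -
    consider "x t" "y t" | "x t" "\<not> y t" | "\<not> x t" "y t" | "\<not> x t" "\<not> y t" by blast
    then show ?thesis
    proof cases
      case 1
      have "m (vadd (vadd x ?e) (vadd y ?e)) = vadd (m (vadd x ?e)) (m (vadd y ?e))"
        using low xy 1 by (intro madd)
      moreover have "vadd (vadd x ?e) (vadd y ?e) = vadd x y" by (auto simp: vadd_def)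
      ultimately show ?thesis using 1 by (simp add: m'_def vt) (auto simp: vadd_def)
    next
      case 2
      have "m (vadd (vadd x ?e) y) = vadd (m (vadd x ?e)) (m y)"
        using low high xy 2 by (intro madd)
      moreover have "vadd (vadd x ?e) y = vadd (vadd x y) ?e" by (auto simp: vadd_def)
      ultimately show ?thesis using 2 by (simp add: m'_def vt) (auto simp: vadd_def)
    next
      case 3
      have "m (vadd x (vadd y ?e)) = vadd (m x) (m (vadd y ?e))"
        using low high xy 3 by (intro madd)
      moreover have "vadd x (vadd y ?e) = vadd (vadd x y) ?e" by (auto simp: vadd_def)
      ultimately show ?thesis using 3 by (simp add: m'_def vt) (auto simp: vadd_def)
    next
      case 4
      then show ?thesis using madd[of x y] high xy by (simp add: m'_def vt)
    qed
  qed
  have ker: "x = zero_vec" if x: "x \<in> ?T t" "m' x = zero_vec" for x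
  proof (cases "x t")
    case True
    then have "w = m (vadd x ?e)" using x(2) by (simp add: m'_def vadd_eq_zero)
    then show ?thesis using w(2) low[OF x(1) True] by blast
  next
    case False
    then have "m x = m zero_vec" using x(2) m0 by (simp add: m'_def)
    then show ?thesis using inj_onD[OF minj _ high[OF x(1) False] zero_tail_space] by blast
  qed
  have m'inj: "inj_on m' (?T t)"
  proof (rule inj_onI)
    fix x y assume xy: "x \<in> ?T t" "y \<in> ?T t" "m' x = m' y"
    then have "m' (vadd x y) = zero_vec" by (simp add: m'add)
    then have "vadd x y = zero_vec" by (rule ker[OF tail_space_vadd[OF xy(1,2)]])
    then show "x = y" by (simp add: vadd_eq_zero)
  qed
  \<comment> \<open>The enlarged member is the union of \<open>W\<close> and its coset through
    \<open>w\<close>.\<close>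
  have mem: "z \<in> m' ` ?T t \<longleftrightarrow> z \<in> ?W \<or> vadd z w \<in> ?W" for z
  proof
    assume "z \<in> m' ` ?T t"
    then obtain x where x: "x \<in> ?T t" "z = m' x" by blast
    show "z \<in> ?W \<or> vadd z w \<in> ?W"
    proof (cases "x t")
      case True
      then have "vadd z w = m (vadd x ?e)" using x(2) by (simp add: m'_def vadd_assoc)
      then show ?thesis using low[OF x(1) True] by blast
    next
      case False
      then show ?thesis using x(2) high[OF x(1) False] by (simp add: m'_def)
    qed
  next
    assume "z \<in> ?W \<or> vadd z w \<in> ?W"
    then show "z \<in> m' ` ?T t"
    proof
      assume "z \<in> ?W"
      then have "z \<in> m' ` ?T (Suc t)" using img by simp
      then show ?thesis using tail_space_mono[of t "Suc t" n] by auto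
    next
      assume "vadd z w \<in> ?W"
      then obtain x where x: "x \<in> ?T (Suc t)" "vadd z w = m x" by blast
      then have xt: "\<not> x t" and xT: "x \<in> ?T t"
        using tail_space_mono[of t "Suc t" n] by (auto simp: tail_space_def)
      have "m' (vadd x ?e) = vadd (m x) w" using xt e by (simp add: m'_def vt vadd_assoc)
      also have "\<dots> = z" by (simp add: x(2)[symmetric] vadd_assoc)
      finally show ?thesis using tail_space_vadd[OF xT e(1)] by blast
    qed
  qed
  have inv_t: "vadd (f x) (f y) \<in> m' ` ?T t"
    if f: "f \<in> \<Sigma>" and V: "x \<in> Vn n" "y \<in> Vn n" and xy: "vadd x y \<in> m' ` ?T t" for f x y
  proof (cases "vadd x y \<in> ?W")
    case True
    then show ?thesis using minv[OF le_refl f V] mem by blast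
  next
    case False
    then have "vadd (vadd x y) w \<in> ?W" using xy mem by blast
    then have "vadd (f (vadd x y)) (f w) \<in> ?W" using minv[OF le_refl f _ w(1)] V by simp
    \<comment> \<open>Adding the fixed-coset relation for \<open>w\<close> cancels
      \<open>f w\<close> and leaves \<open>f x + f y + w\<close>, so the new direction lies in the
      coset of \<open>w\<close>.\<close>
    then have "vadd (vadd (f (vadd x y)) (f w)) (vadd w (vadd (f w) (f zero_vec))) \<in> ?W"
      using w(3)[OF f] by (rule Wadd)
    moreover have "f (vadd x y) = vadd (vadd (f x) (f y)) (f zero_vec)"
      using AGL_vadd3[OF subsetD[OF SA f] V zero_vec_Vn] by simp
    moreover have "vadd (vadd (vadd (vadd p q) r) s) (vadd w (vadd s r)) = vadd (vadd p q) w" for p q r s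
      by (auto simp: vadd_def)
    ultimately show ?thesis using mem by simp
  qed
  have m'inv: "vadd (f x) (f y) \<in> m' ` ?T j"
    if "t \<le> j" "f \<in> \<Sigma>" "x \<in> Vn n" "y \<in> Vn n" "vadd x y \<in> m' ` ?T j" for j f x y
  proof (cases "j = t")
    case True
    then show ?thesis using inv_t that by blast
  next
    case False
    then have "Suc t \<le> j" using that(1) by simp
    then show ?thesis using minv that img by simp
  qed
  show ?case
    unfolding invariant_flag_map_def
    by (intro exI[of _ m'] conjI ballI allI impI m'V m'add m'inj) (assumption | rule m'inv)+
qed

section \<open>Sylow subgroups as conjugates of the triangular affine group\<close>

text \<open>A full invariant flag is the image of the standard one under a linear bijection
  \<open>c\<close>; conjugating by \<open>c\<close> makes the standard flag invariant.\<close>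

lemma conj_into_Unitri:
  assumes S: "subgroup \<Sigma> (SymV n)" and SA: "\<Sigma> \<subseteq> AGL n" and cS: "card \<Sigma> = 2 ^ a"
  shows "\<exists>c\<in>AGL n. \<forall>f\<in>\<Sigma>. inv\<^bsub>SymV n\<^esub> c \<otimes>\<^bsub>SymV n\<^esub> f \<otimes>\<^bsub>SymV n\<^esub> c \<in> Unitri n"
proof -
  interpret group "SymV n" by (rule group_BijGroup)
  obtain m where m: "invariant_flag_map n \<Sigma> 0 m"
    using invariant_flag_map_exists[OF S SA cS le0] by blast
  note mV = invariant_flag_mapD(1)[OF m, unfolded tail_space_0]
    and madd = invariant_flag_mapD(2)[OF m, unfolded tail_space_0]
    and minj = invariant_flag_mapD(3)[OF m, unfolded tail_space_0]
    and minv = invariant_flag_mapD(4)[OF m le0]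
  define c where "c = restrict m (Vn n)"
  have cB: "c \<in> Bij (Vn n)" unfolding c_def using mV minj by (rule restrict_Bij)
  have cx: "c x = m x" if "x \<in> Vn n" for x using that by (simp add: c_def)
  have cA: "c \<in> AGL n"
  proof (rule AGLI[OF cB], rule affine_funI)
    fix i x y z assume "x \<in> Vn n" "y \<in> Vn n" "z \<in> Vn n"
    then have "c (vadd (vadd x y) z) = vadd (vadd (c x) (c y)) (c z)" by (simp add: cx madd)
    then show "c (vadd (vadd x y) z) i = (c x i \<noteq> (c y i \<noteq> c z i))" by (auto simp: vadd_def)
  qed
  let ?i = "inv\<^bsub>SymV n\<^esub> c"
  define \<kappa> where "\<kappa> = (\<lambda>f. ?i \<otimes>\<^bsub>SymV n\<^esub> f \<otimes>\<^bsub>SymV n\<^esub> c)"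
  have fB: "f \<in> Bij (Vn n)" if "f \<in> \<Sigma>" for f using that SA by auto
  have \<kappa>x: "\<kappa> f x = ?i (f (c x))" if "f \<in> \<Sigma>" "x \<in> Vn n" for f x
    using that fB cB by (simp add: \<kappa>_def)
  have \<kappa>A: "\<kappa> f \<in> AGL n" if "f \<in> \<Sigma>" for f
    unfolding \<kappa>_def using that SA cA
    by (intro subgroup.m_closed[OF subgroup_AGL] subgroup.m_inv_closed[OF subgroup_AGL]) auto
  have dir: "agree i (\<kappa> f x) (\<kappa> f y)"
    if f: "f \<in> \<Sigma>" and V: "x \<in> Vn n" "y \<in> Vn n" and a: "agree i x y" for f x y i
  proof -
    have "vadd x y \<in> tail_space n i" using a V by (simp add: tail_space_iff)
    then have "vadd (c x) (c y) \<in> m ` tail_space n i"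
      using V by (simp add: cx madd[symmetric])
    then have "vadd (f (c x)) (f (c y)) \<in> m ` tail_space n i"
      using minv[OF f] V cB by simp
    then obtain z where z: "z \<in> tail_space n i" "vadd (f (c x)) (f (c y)) = m z" by blast
    have zV: "z \<in> Vn n" using z(1) tail_space_subset by blast
    have K: "\<kappa> f x \<in> Vn n" "\<kappa> f y \<in> Vn n" using V \<kappa>A[OF f] by simp_all
    have "f (c u) = m (\<kappa> f u)" if "u \<in> Vn n" for u
      using that K fB[OF f] cB by (simp add: \<kappa>x[OF f] cx[symmetric])
    then have "m (vadd (\<kappa> f x) (\<kappa> f y)) = m z" using z(2) V K by (simp add: madd)
    then have "vadd (\<kappa> f x) (\<kappa> f y) = z" using inj_onD[OF minj] K zV by simp
    then show ?thesis using z(1) K by (simp add: tail_space_iff[symmetric])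
  qed
  have "\<kappa> f \<in> Unitri n" if f: "f \<in> \<Sigma>" for f
  proof (rule UnitriI)
    show "affine_fun n (\<lambda>x. \<kappa> f x i)" for i by (rule AGL_affine[OF \<kappa>A[OF f]])
    show "\<kappa> f \<in> Tri n"
    proof (rule TriI)
      show "\<kappa> f \<in> Bij (Vn n)" using \<kappa>A[OF f] by simp
      fix i x y assume V: "x \<in> Vn n" "y \<in> Vn n"
      \<comment> \<open>\<open>dir\<close> gives only one implication of the triangularity
        condition; the other follows from \<open>dir\<close> for the inverse of
        \<open>f\<close>.\<close>
      let ?g = "inv\<^bsub>SymV n\<^esub> f"
      have g: "?g \<in> \<Sigma>" by (rule subgroup.m_inv_closed[OF S f])
      have K: "\<kappa> f u \<in> Vn n" if "u \<in> Vn n" for u using that \<kappa>A[OF f] by simp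
      have undo: "\<kappa> ?g (\<kappa> f u) = u" if "u \<in> Vn n" for u
        using that K[OF that] fB[OF f] cB by (simp add: \<kappa>x[OF g] \<kappa>x[OF f])
      show "agree i (\<kappa> f x) (\<kappa> f y) = agree i x y"
        using dir[OF f V] dir[OF g K[OF V(1)] K[OF V(2)]] undo V by auto
    qed
  qed
  then show ?thesis using cA unfolding \<kappa>_def by blast
qed

theorem mainTheorem16:
  fixes n :: nat and \<Sigma> :: "((nat \<Rightarrow> bool) \<Rightarrow> (nat \<Rightarrow> bool)) set"
  assumes "n > 2"
    and "sylow_subgroup (AGL_group n) 2 \<Sigma>"
  shows "card (rcosets\<^bsub>(BijGroup (Vn n))\<lparr>carrier := normalizer (BijGroup (Vn n)) \<Sigma>\<rparr>\<^esub> \<Sigma>) = 2"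
proof -
  interpret group "SymV n" by (rule group_BijGroup)
  obtain a where sub: "subgroup \<Sigma> (AGL_group n)" and cS: "card \<Sigma> = 2 ^ a"
    and max: "\<not> 2 ^ Suc a dvd card (AGL n)"
    using assms(2) by (auto simp: sylow_subgroup_def AGL_group_def)
  have SA: "\<Sigma> \<subseteq> AGL n" using subgroup.subset[OF sub] by (simp add: AGL_group_def)
  have S: "subgroup \<Sigma> (SymV n)"
    using incl_subgroup[OF subgroup_AGL] sub by (simp add: AGL_group_def)
  obtain c where c: "c \<in> AGL n"
    and conj: "\<And>f. f \<in> \<Sigma> \<Longrightarrow> inv\<^bsub>SymV n\<^esub> c \<otimes>\<^bsub>SymV n\<^esub> f \<otimes>\<^bsub>SymV n\<^esub> c \<in> Unitri n"
    using conj_into_Unitri[OF S SA cS] by blast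
  let ?\<kappa> = "\<lambda>f. inv\<^bsub>SymV n\<^esub> c \<otimes>\<^bsub>SymV n\<^esub> f \<otimes>\<^bsub>SymV n\<^esub> c"
  have cB: "c \<in> Bij (Vn n)" using c by simp
  obtain b where b: "card (Unitri n) = 2 ^ b" using card_Unitri by blast
  have "subgroup (Unitri n) (SymV n\<lparr>carrier := AGL n\<rparr>)"
    by (rule subgroup_incl[OF subgroup_Unitri subgroup_AGL]) auto
  then have "card (Unitri n) dvd order (SymV n\<lparr>carrier := AGL n\<rparr>)"
    using group.lagrange[OF subgroup.subgroup_is_group[OF subgroup_AGL group_BijGroup]]
    by (metis dvd_triv_right)
  then have "2 ^ b dvd card (AGL n)" by (simp add: b order_def)
  \<comment> \<open>Lagrange's theorem makes \<open>2 ^ b\<close> a divisor of the order of the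
    affine group, where \<open>2 ^ a\<close> is the full power of two.\<close>
  then have "b \<le> a" using max by (meson dvd_trans le_imp_power_dvd not_less_eq_eq)
  have "inj_on ?\<kappa> \<Sigma>"
    using SA cB by (auto simp: inj_on_def subset_iff)
  then have "card (?\<kappa> ` \<Sigma>) = 2 ^ a" by (simp add: card_image cS)
  moreover have "finite (Unitri n)" by (rule card_ge_0_finite) (simp add: b)
  \<comment> \<open>The conjugate lies inside \<open>Unitri n\<close> and has at least as many
    elements, so the two coincide.\<close>
  ultimately have "?\<kappa> ` \<Sigma> = Unitri n"
    using conj b \<open>b \<le> a\<close> by (intro card_seteq) auto
  moreover have "quad_shear n \<notin> Unitri n"
    using quad_shear_not_affine[OF assms(1)] UnitriD(2) by blast
  ultimately show ?thesis
    using cB normalizer_Unitri[OF assms(1)]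
    by (intro index_normalizer_conj[OF S subgroup_Unitri, of c "quad_shear n"]) simp_all
qed

end
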